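(* Consider Problem (B) with initial data $(\rho,u,E)(0,x)=(1,-1,E_0)$ for $x<0$, $\gamma>1$, $E_0>1/2$, Mach number $0<M_0<\infty$. Then Problem (B) has a self-similar integral weak solution $U(t,x;M_0)=V(x/t)$ consisting of constant states and a 1-rarefaction wave, in which the rarefaction states satisfy $u=-1+\frac{2}{(\gamma-1)M_0}\big(1-\rho^{(\gamma-1)/2}\big)$, $p=(\gamma-1)(E_0-\tfrac12)\rho^\gamma$, and $\frac xt=u-c$ with $c=\frac1{M_0}\rho^{(\gamma-1)/2}$. If $M_0<\frac{2}{\gamma-1}$ there is no vacuum: the solution is $(1,-1,E_0)$ for $x/t\le -1-\frac1{M_0}$, the rarefaction wave, and the constant state with $u=0$, $\rho=\rho_1=\big(1-\frac{(\gamma-1)M_0}{2}\big)^{2/(\gamma-1)}>0$ adjacent to the piston. If $M_0>\frac2{\gamma-1}$ a vacuum region $\{-1+\frac{2}{(\gamma-1)M_0}\le x/t\le 0\}$ appears ahead of the piston. (Case 1) For fixed $\gamma>1$, as $E_0\downarrow1/2$ ($M_0\to\infty$), vacuum is present for all sufficiently large $M_0$, and the measures $\rho\mathcal L^2,\rho u\mathcal L^2,\rho u^2\mathcal L^2,\rho E\mathcal L^2,\rho uE\mathcal L^2, up\mathcal L^2, p\mathcal L^2$ built from $U(\cdot;M_0)$ converge weakly as measures to those built from $$U(t,x;\infty)=\begin{cases}(1,-1,\tfrac12),& x/t\le-1,\\ (0,0,0),& -1<x/t\le0,\end{cases}$$ (with limiting pressure measures $\wp=0$, $n^2=0$), which is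 a weak solution of the pressureless Euler system $\partial_t\rho+\partial_x(\rho u)=0$, $\partial_t(\rho u)+\partial_x(\rho u^2)=0$, $\partial_t(\rho E)+\partial_x(\rho uE)=0$ containing a contact discontinuity $x=-t$ and vacuum. (Case 2) For fixed $E_0>1/2$, as $\gamma\downarrow1$ ($M_0\to\infty$, where $1/M_0^2=\gamma(\gamma-1)(E_0-\frac12)$), one has $(\gamma-1)M_0\to0$, so there is no vacuum for all $\gamma>1$ sufficiently close to $1$; nevertheless the same measures converge weakly as measures to those built from $$U'(t,x;\infty)=\begin{cases}(1,-1,E_0),& x/t\le-1,\\ (0,0,0),& -1<x/t\le0,\end{cases}$$ (with limiting $\wp=0$, $n^2=0$), which is a weak solution of the pressureless Euler system above with vacuum.
   Context: Setting: $\Omega=\{(t,x):x<0,\ t>0\}$, piston $P=\{(t,0):t\ge0\}$. Problem (B): the one-dimensional full compressible Euler system $\partial_t\rho+\partial_x(\rho u)=0$, $\partial_t(\rho u)+\partial_x(\rho u^2+p)=0$, $\partial_t(\rho E)+\partial_x(\rho uE+up)=0$ in $\Omega$, with $p=(\gamma-1)\rho(E-\frac12u^2)$, boundary condition $u=0$ on $P$, and initial data $(\rho,u,E)(0,x)=(1,-1,E_0)$, $x<0$. The initial pressure is $p_0=(\gamma-1)(E_0-\frac12)$, sound speed $c=\sqrt{\gamma p/\rho}$, and the Mach number satisfies $\frac1{M_0^2}=\gamma(\gamma-1)(E_0-\frac12)$ (so the initial sound speed is $1/M_0$). The first characteristic speed is $\lambda_1=u-c$. Integral weak solution: $(\rho,u,E)\in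 L^\infty(\Omega;\mathbb R^3)$ such that for all $\phi\in C^1_0(\mathbb R^2)$: $\int_\Omega(\rho\phi_t+\rho u\phi_x)+\int_{-\infty}^0\rho_0\phi(0,x)dx=0$; $\int_\Omega(\rho u\phi_t+(\rho u^2+p)\phi_x)-\int_0^\infty p(t,0)\phi(t,0)dt+\int_{-\infty}^0\rho_0u_0\phi(0,x)dx=0$; $\int_\Omega(\rho E\phi_t+(\rho uE+up)\phi_x)+\int_{-\infty}^0\rho_0E_0\phi(0,x)dx=0$; and discontinuities satisfy the Lax entropy condition. Weak convergence as measures means convergence of $\int\phi\,d\mu_k\to\int\phi\,d\mu$ for all $\phi\in C_0(\mathbb R^2)$, for each of the listed measures ($\mathcal L^2$ = Lebesgue measure on $\mathbb R^2$). *)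

theory Defs
  imports "HOL-Analysis.Analysis"
begin

type_synonym state = "real \<times> real \<times> real"

definition Omega :: "(real \<times> real) set" where
  "Omega = {(t, x). x < 0 \<and> t > 0}"

definition dens :: "state \<Rightarrow> real" where "dens s = fst s"
definition vel :: "state \<Rightarrow> real" where "vel s = fst (snd s)"
definition energy :: "state \<Rightarrow> real" where "energy s = snd (snd s)"

definition pres :: "real \<Rightarrow> state \<Rightarrow> real" where
  "pres \<gamma> s = (\<gamma> - 1) * dens s * (energy s - (vel s)\<^sup>2 / 2)"

definition sound :: "real \<Rightarrow> state \<Rightarrow> real" where
  "sound \<gamma> s = sqrt (\<gamma> * pres \<gamma> s / dens s)"

definition lam1 :: "real \<Rightarrow> state \<Rightarrow> real" where "lam1 \<gamma> s = vel s - sound \<gamma> s"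
definition lam2 :: "real \<Rightarrow> state \<Rightarrow> real" where "lam2 \<gamma> s = vel s"
definition lam3 :: "real \<Rightarrow> state \<Rightarrow> real" where "lam3 \<gamma> s = vel s + sound \<gamma> s"

definition mach :: "real \<Rightarrow> real \<Rightarrow> real" where
  "mach \<gamma> E0 = 1 / sqrt (\<gamma> * (\<gamma> - 1) * (E0 - 1/2))"

definition test_fun :: "(real \<times> real \<Rightarrow> real) \<Rightarrow> bool" where
  "test_fun \<phi> \<longleftrightarrow> (\<forall>z. \<phi> differentiable (at z))
      \<and> continuous_on UNIV (\<lambda>z. frechet_derivative \<phi> (at z) (1, 0))
      \<and> continuous_on UNIV (\<lambda>z. frechet_derivative \<phi> (at z) (0, 1))
      \<and> bounded {z. \<phi> z \<noteq> 0}"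

definition Dt :: "(real \<times> real \<Rightarrow> real) \<Rightarrow> real \<times> real \<Rightarrow> real" where
  "Dt \<phi> z = frechet_derivative \<phi> (at z) (1, 0)"
definition Dx :: "(real \<times> real \<Rightarrow> real) \<Rightarrow> real \<times> real \<Rightarrow> real" where
  "Dx \<phi> z = frechet_derivative \<phi> (at z) (0, 1)"

definition cc_fun :: "(real \<times> real \<Rightarrow> real) \<Rightarrow> bool" where
  "cc_fun \<phi> \<longleftrightarrow> continuous_on UNIV \<phi> \<and> bounded {z. \<phi> z \<noteq> 0}"

definition Linf_Omega :: "(real \<times> real \<Rightarrow> real) \<Rightarrow> bool" where
  "Linf_Omega f \<longleftrightarrow> f \<in> borel_measurable lborel \<and>
      (\<exists>B. AE z in lborel. z \<in> Omega \<longrightarrow> \<bar>f z\<bar> \<le> B)"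

text \<open>The integral identities of an integral weak solution of Problem (B)
  (full Euler with pressure law p, piston boundary u = 0 at x = 0),
  with initial data (rho0, u0, E0).\<close>
definition euler_integral_identities ::
  "real \<Rightarrow> (real \<times> real \<Rightarrow> state) \<Rightarrow> (real \<Rightarrow> real) \<Rightarrow> (real \<Rightarrow> real) \<Rightarrow> (real \<Rightarrow> real) \<Rightarrow> bool" where
  "euler_integral_identities \<gamma> U rho0 u0 E0 \<longleftrightarrow>
     Linf_Omega (\<lambda>z. dens (U z)) \<and> Linf_Omega (\<lambda>z. vel (U z)) \<and> Linf_Omega (\<lambda>z. energy (U z)) \<and>
     (\<forall>\<phi>. test_fun \<phi> \<longrightarrow>
        (LINT z:Omega|lborel. dens (U z) * Dt \<phi> z + dens (U z) * vel (U z) * Dx \<phi> z)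
        + (LINT x:{..0}|lborel. rho0 x * \<phi> (0, x)) = 0
      \<and> (LINT z:Omega|lborel. dens (U z) * vel (U z) * Dt \<phi> z
             + (dens (U z) * (vel (U z))\<^sup>2 + pres \<gamma> (U z)) * Dx \<phi> z)
        - (LINT t:{0..}|lborel. pres \<gamma> (U (t, 0)) * \<phi> (t, 0))
        + (LINT x:{..0}|lborel. rho0 x * u0 x * \<phi> (0, x)) = 0
      \<and> (LINT z:Omega|lborel. dens (U z) * energy (U z) * Dt \<phi> z
             + (dens (U z) * vel (U z) * energy (U z) + vel (U z) * pres \<gamma> (U z)) * Dx \<phi> z)
        + (LINT x:{..0}|lborel. rho0 x * E0 x * \<phi> (0, x)) = 0)"

definition pressureless_weak_solution ::
  "(real \<times> real \<Rightarrow> state) \<Rightarrow> (real \<Rightarrow> real) \<Rightarrow> (real \<Rightarrow> real) \<Rightarrow> (real \<Rightarrow> real) \<Rightarrow> bool" where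
  "pressureless_weak_solution U rho0 u0 E0 \<longleftrightarrow>
     Linf_Omega (\<lambda>z. dens (U z)) \<and> Linf_Omega (\<lambda>z. vel (U z)) \<and> Linf_Omega (\<lambda>z. energy (U z)) \<and>
     (\<forall>\<phi>. test_fun \<phi> \<longrightarrow>
        (LINT z:Omega|lborel. dens (U z) * Dt \<phi> z + dens (U z) * vel (U z) * Dx \<phi> z)
        + (LINT x:{..0}|lborel. rho0 x * \<phi> (0, x)) = 0
      \<and> (LINT z:Omega|lborel. dens (U z) * vel (U z) * Dt \<phi> z
             + dens (U z) * (vel (U z))\<^sup>2 * Dx \<phi> z)
        + (LINT x:{..0}|lborel. rho0 x * u0 x * \<phi> (0, x)) = 0
      \<and> (LINT z:Omega|lborel. dens (U z) * energy (U z) * Dt \<phi> z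
             + dens (U z) * vel (U z) * energy (U z) * Dx \<phi> z)
        + (LINT x:{..0}|lborel. rho0 x * E0 x * \<phi> (0, x)) = 0)"

text \<open>Lax entropy condition for a discontinuity of speed s with left state L and right
  state R (k = 1, 2 (non-strict, linearly degenerate), 3).\<close>
definition lax_admissible :: "real \<Rightarrow> real \<Rightarrow> state \<Rightarrow> state \<Rightarrow> bool" where
  "lax_admissible \<gamma> s L R \<longleftrightarrow>
     (lam1 \<gamma> R < s \<and> s < lam1 \<gamma> L \<and> s < lam2 \<gamma> R)
   \<or> (lam2 \<gamma> R \<le> s \<and> s \<le> lam2 \<gamma> L \<and> lam1 \<gamma> L < s \<and> s < lam3 \<gamma> R)
   \<or> (lam3 \<gamma> R < s \<and> s < lam3 \<gamma> L \<and> lam2 \<gamma> L < s)"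

definition ss_lax_entropy :: "real \<Rightarrow> (real \<Rightarrow> state) \<Rightarrow> bool" where
  "ss_lax_entropy \<gamma> V \<longleftrightarrow>
     (\<forall>s L R. s < 0 \<and> (V \<longlongrightarrow> L) (at_left s) \<and> (V \<longlongrightarrow> R) (at_right s) \<and> L \<noteq> R
        \<and> dens L > 0 \<and> dens R > 0 \<longrightarrow> lax_admissible \<gamma> s L R)"

definition ss_field :: "(real \<Rightarrow> state) \<Rightarrow> real \<times> real \<Rightarrow> state" where
  "ss_field V z = V (snd z / fst z)"

definition ss_weak_solution_B :: "real \<Rightarrow> real \<Rightarrow> (real \<Rightarrow> state) \<Rightarrow> bool" where
  "ss_weak_solution_B \<gamma> E0 V \<longleftrightarrow>
     euler_integral_identities \<gamma> (ss_field V) (\<lambda>_. 1) (\<lambda>_. -1) (\<lambda>_. E0)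
     \<and> ss_lax_entropy \<gamma> V"

definition rarefaction_state :: "real \<Rightarrow> real \<Rightarrow> real \<Rightarrow> state \<Rightarrow> bool" where
  "rarefaction_state \<gamma> E0 \<xi> s \<longleftrightarrow>
     (let M0 = mach \<gamma> E0; \<rho> = dens s; u = vel s in
       \<rho> > 0
       \<and> u = -1 + 2 / ((\<gamma> - 1) * M0) * (1 - \<rho> powr ((\<gamma> - 1) / 2))
       \<and> pres \<gamma> s = (\<gamma> - 1) * (E0 - 1/2) * \<rho> powr \<gamma>
       \<and> \<xi> = u - (1 / M0) * \<rho> powr ((\<gamma> - 1) / 2))"

definition piston_structure :: "real \<Rightarrow> real \<Rightarrow> (real \<Rightarrow> state) \<Rightarrow> bool" where
  "piston_structure \<gamma> E0 V \<longleftrightarrow>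
     (let M0 = mach \<gamma> E0;
          \<xi>R = (if M0 \<le> 2 / (\<gamma> - 1) then (\<gamma> - 1) / 2 - 1 / M0
                else -1 + 2 / ((\<gamma> - 1) * M0));
          \<rho>1 = (1 - (\<gamma> - 1) * M0 / 2) powr (2 / (\<gamma> - 1)) in
       (\<forall>\<xi>. \<xi> \<le> -1 - 1 / M0 \<longrightarrow> V \<xi> = (1, -1, E0))
       \<and> (\<forall>\<xi>. -1 - 1 / M0 < \<xi> \<and> \<xi> < \<xi>R \<longrightarrow> rarefaction_state \<gamma> E0 \<xi> (V \<xi>))
       \<and> (M0 < 2 / (\<gamma> - 1) \<longrightarrow> \<rho>1 > 0 \<and>
            (\<exists>E1. \<forall>\<xi>. \<xi>R \<le> \<xi> \<and> \<xi> \<le> 0 \<longrightarrow> V \<xi> = (\<rho>1, 0, E1)))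
       \<and> (M0 > 2 / (\<gamma> - 1) \<longrightarrow> (\<forall>\<xi>. \<xi>R \<le> \<xi> \<and> \<xi> \<le> 0 \<longrightarrow> dens (V \<xi>) = 0)))"

definition piston_solution :: "real \<Rightarrow> real \<Rightarrow> (real \<Rightarrow> state) \<Rightarrow> bool" where
  "piston_solution \<gamma> E0 V \<longleftrightarrow> ss_weak_solution_B \<gamma> E0 V \<and> piston_structure \<gamma> E0 V"

definition limit_profile :: "real \<Rightarrow> real \<Rightarrow> state" where
  "limit_profile Einf \<xi> = (if \<xi> \<le> -1 then (1, -1, Einf) else (0, 0, 0))"

definition measures_converge ::
  "(real \<Rightarrow> real) \<Rightarrow> (real \<Rightarrow> real \<Rightarrow> state) \<Rightarrow> real filter \<Rightarrow> (real \<Rightarrow> state) \<Rightarrow> bool" where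
  "measures_converge g V F W \<longleftrightarrow>
    (\<forall>\<phi>. cc_fun \<phi> \<longrightarrow>
      ((\<lambda>k. LINT z:Omega|lborel. dens (ss_field (V k) z) * \<phi> z)
         \<longlongrightarrow> (LINT z:Omega|lborel. dens (ss_field W z) * \<phi> z)) F
    \<and> ((\<lambda>k. LINT z:Omega|lborel. dens (ss_field (V k) z) * vel (ss_field (V k) z) * \<phi> z)
         \<longlongrightarrow> (LINT z:Omega|lborel. dens (ss_field W z) * vel (ss_field W z) * \<phi> z)) F
    \<and> ((\<lambda>k. LINT z:Omega|lborel. dens (ss_field (V k) z) * (vel (ss_field (V k) z))\<^sup>2 * \<phi> z)
         \<longlongrightarrow> (LINT z:Omega|lborel. dens (ss_field W z) * (vel (ss_field W z))\<^sup>2 * \<phi> z)) F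
    \<and> ((\<lambda>k. LINT z:Omega|lborel. dens (ss_field (V k) z) * energy (ss_field (V k) z) * \<phi> z)
         \<longlongrightarrow> (LINT z:Omega|lborel. dens (ss_field W z) * energy (ss_field W z) * \<phi> z)) F
    \<and> ((\<lambda>k. LINT z:Omega|lborel. dens (ss_field (V k) z) * vel (ss_field (V k) z) * energy (ss_field (V k) z) * \<phi> z)
         \<longlongrightarrow> (LINT z:Omega|lborel. dens (ss_field W z) * vel (ss_field W z) * energy (ss_field W z) * \<phi> z)) F
    \<and> ((\<lambda>k. LINT z:Omega|lborel. vel (ss_field (V k) z) * pres (g k) (ss_field (V k) z) * \<phi> z) \<longlongrightarrow> 0) F
    \<and> ((\<lambda>k. LINT z:Omega|lborel. pres (g k) (ss_field (V k) z) * \<phi> z) \<longlongrightarrow> 0) F)"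

end

theory Submission
  imports Defs
begin

text \<open>For a function of \<xi> = x / t the law reads - \<xi> * F' + G' = 0, that is (G - \<xi>
  * F)' = - F, where neither F nor G is differentiated alone. Continuity of H across a ray is the
  Rankine-Hugoniot condition for speed \<xi>. Convergence holds for the measures, not for the
  states. In the second case the velocity at a fixed \<xi> between -1 and 0 tends to \<xi>, while
  the limit profile has velocity 0 there. Hence every quantity is controlled through its factor
  \<rho> or p, never through u or E separately. The two cases lose their mass differently. With
  \<gamma> fixed, the vacuum edge moves to \<xi> = -1, so the density at a fixed \<xi> is eventually
  exactly 0. As \<gamma> tends to 1, the density stays positive up to the piston, and \<rho> =
  \<open>w powr q\<close> is of the form 1 to the power infinity: w tends to 1 while q = 2 /
  (\<gamma> - 1) grows. The exponential bound settles this, because q * (1 - w) is of the order (1 +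
  \<xi>) / s, with s the vanishing initial sound speed.\<close>

text \<open>A self-similar pair \<open>(F, G)(x / t)\<close> satisfies the weak form of \<open>\<partial>\<^sub>t F + \<partial>\<^sub>x G = 0\<close> as soon as
  \<open>H \<xi> = G \<xi> - \<xi> * F \<xi>\<close> is continuous with \<open>H' = - F\<close> off finitely many points. Neither \<open>F\<close> nor \<open>G\<close>
  need be differentiable, so one identity covers the fan up to the vacuum and the contact
  discontinuity of the limit. Along the fan \<open>H' = - F\<close> is an ODE in the scaled sound speed.

  The Lax condition forces every solution with the prescribed structure to agree with the explicit
  fan up to vacuum states, which carry no mass. Hence the weak limits follow from dominated
  convergence: \<open>0 \<le> \<rho> \<le> 1\<close> and \<open>\<bar>u\<bar> \<le> 1\<close>, the pressure tends to \<open>0\<close> uniformly, the state is constant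
  for \<open>x / t < - 1\<close> in the limit, and \<open>\<rho>\<close> tends to \<open>0\<close> for \<open>- 1 < x / t < 0\<close>. In the second case the
  last point comes from \<open>w \<le> exp (w - 1)\<close>.\<close>

section \<open>Integration over the quarter plane\<close>

lemma integrable_bounded_support:
  fixes f :: "'a::euclidean_space \<Rightarrow> real"
  assumes "f \<in> borel_measurable borel" "\<And>z. \<bar>f z\<bar> \<le> B" "\<And>z. norm z > R \<Longrightarrow> f z = 0"
  shows "integrable lborel f"
proof (rule integrableI_bounded_set)
  show "cball 0 R \<in> sets lborel" by simp
  show "f \<in> borel_measurable lborel" using assms(1) by simp
  show "emeasure lborel (cball (0::'a) R) < \<infinity>"
    by (rule emeasure_bounded_finite) auto
  show "AE x in lborel. x \<in> cball 0 R \<longrightarrow> norm (f x) \<le> B" using assms(2) by auto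
  show "AE x in lborel. x \<notin> cball 0 R \<longrightarrow> f x = 0" using assms(3) by auto
qed

text \<open>The exceptional set \<open>S\<close> admits the kink at the end of the fan. The
  fundamental theorem yields a gauge integral; measurability and the bound turn it into a Lebesgue
  integral.\<close>

lemma LINT_derivative:
  fixes F f :: "real \<Rightarrow> real"
  assumes ab: "a \<le> b" and cont: "continuous_on {a..b} F" and S: "finite S"
    and der: "\<And>x. x \<in> {a<..<b} - S \<Longrightarrow> (F has_real_derivative f x) (at x)"
    and meas: "f \<in> borel_measurable borel" and bd: "\<And>x. x \<in> {a..b} \<Longrightarrow> \<bar>f x\<bar> \<le> B"
  shows "(LINT x:{a..b}|lborel. f x) = F b - F a"
proof -
  have "(f has_integral (F b - F a)) {a..b}"
    by (rule fundamental_theorem_of_calculus_interior_strong[OF S ab _ cont])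
      (use der in \<open>auto simp: has_real_derivative_iff_has_vector_derivative\<close>)
  moreover have "set_integrable lborel {a..b} f"
    unfolding set_integrable_def
    by (rule integrable_bounded_support[where B = "\<bar>B\<bar>" and R = "max \<bar>a\<bar> \<bar>b\<bar>"])
      (use meas bd in \<open>auto simp: indicator_def intro: order_trans[OF bd]\<close>)
  ultimately show ?thesis
    using set_borel_integral_eq_integral(2) integral_unique by metis
qed

section \<open>Test functions: chain rule, support and bounds\<close>

lemma test_fun_has_derivative:
  assumes "test_fun \<phi>"
  shows "(\<phi> has_derivative (\<lambda>(a, b). a * Dt \<phi> z + b * Dx \<phi> z)) (at z)"
proof -
  have d: "(\<phi> has_derivative frechet_derivative \<phi> (at z)) (at z)"
    using assms frechet_derivative_works unfolding test_fun_def by blast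
  then interpret bounded_linear "frechet_derivative \<phi> (at z)"
    by (rule has_derivative_bounded_linear)
  have "frechet_derivative \<phi> (at z) (a, b) = a * Dt \<phi> z + b * Dx \<phi> z" for a b
  proof -
    have "(a, b) = a *\<^sub>R (1, 0) + b *\<^sub>R (0, 1)" by simp
    then show ?thesis by (simp only: add scaleR Dt_def Dx_def) simp
  qed
  then have "frechet_derivative \<phi> (at z) = (\<lambda>(a, b). a * Dt \<phi> z + b * Dx \<phi> z)" by auto
  with d show ?thesis by simp
qed

lemma test_fun_curve_derivative:
  assumes "test_fun \<phi>" "(p has_real_derivative p') (at s)" "(q has_real_derivative q') (at s)"
  shows "((\<lambda>s. \<phi> (p s, q s)) has_real_derivative
           p' * Dt \<phi> (p s, q s) + q' * Dx \<phi> (p s, q s)) (at s)"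
proof -
  have "((\<lambda>s. (p s, q s)) has_derivative (\<lambda>h. (p' * h, q' * h))) (at s)"
    by (rule has_derivative_Pair) (use assms in \<open>auto simp: has_field_derivative_def\<close>)
  from has_derivative_compose[OF this test_fun_has_derivative[OF assms(1)]]
  show ?thesis
    unfolding has_field_derivative_def by (rule has_derivative_eq_rhs) (auto simp: algebra_simps)
qed

lemma test_fun_continuous:
  assumes "test_fun \<phi>"
  shows "continuous_on UNIV \<phi>" "continuous_on UNIV (Dt \<phi>)" "continuous_on UNIV (Dx \<phi>)"
proof -
  show "continuous_on UNIV \<phi>"
    using assms unfolding test_fun_def
    by (intro continuous_at_imp_continuous_on ballI differentiable_imp_continuous_within) blast
qed (use assms in \<open>auto simp: test_fun_def Dt_def[abs_def] Dx_def[abs_def]\<close>)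

text \<open>The complement of a closed ball is open, so \<open>\<phi>\<close> vanishes in a
  neighbourhood of each outer point and its derivative vanishes there as well.\<close>

lemma test_fun_support:
  assumes "test_fun \<phi>"
  obtains R where "R > 0" "\<And>z. norm z > R \<Longrightarrow> \<phi> z = 0 \<and> Dt \<phi> z = 0 \<and> Dx \<phi> z = 0"
proof -
  obtain R where R: "R > 0" "\<And>z. \<phi> z \<noteq> 0 \<Longrightarrow> norm z \<le> R"
    using assms unfolding test_fun_def bounded_pos by auto
  have "\<phi> z = 0 \<and> Dt \<phi> z = 0 \<and> Dx \<phi> z = 0" if z: "norm z > R" for z
  proof -
    have "((\<lambda>_. 0) has_derivative (\<lambda>_. 0)) (at z)" by simp
    then have "(\<phi> has_derivative (\<lambda>_. 0)) (at z)"
      by (rule has_derivative_transform_within_open[where s = "- cball 0 R"])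
        (use z R(2) in \<open>auto simp: open_Compl not_le[symmetric]\<close>)
    then have "frechet_derivative \<phi> (at z) = (\<lambda>_. 0)" by (metis frechet_derivative_at)
    moreover have "\<phi> z = 0" using R(2)[of z] z by linarith
    ultimately show ?thesis by (simp add: Dt_def Dx_def)
  qed
  with R that show thesis by blast
qed

lemma continuous_bounded_support:
  fixes f :: "'a::euclidean_space \<Rightarrow> real"
  assumes "continuous_on UNIV f" "\<And>z. norm z > R \<Longrightarrow> f z = 0"
  obtains B where "B > 0" "\<And>z. \<bar>f z\<bar> \<le> B"
proof -
  have "compact (f ` cball 0 R)"
    using assms(1) by (intro compact_continuous_image continuous_on_subset[OF assms(1)]) auto
  then obtain B where B: "B > 0" "\<And>z. norm z \<le> R \<Longrightarrow> \<bar>f z\<bar> \<le> B"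
    using compact_imp_bounded[of "f ` cball 0 R"] by (auto simp: bounded_pos)
  show thesis
  proof (rule that[OF B(1)])
    show "\<bar>f z\<bar> \<le> B" for z
      using B assms(2)[of z] by (cases "norm z \<le> R") auto
  qed
qed

lemma test_fun_bounds:
  assumes "test_fun \<phi>"
  obtains B R where "B > 0" "R > 0"
    "\<And>z. \<bar>\<phi> z\<bar> \<le> B" "\<And>z. \<bar>Dt \<phi> z\<bar> \<le> B" "\<And>z. \<bar>Dx \<phi> z\<bar> \<le> B"
    "\<And>z. norm z > R \<Longrightarrow> \<phi> z = 0" "\<And>z. norm z > R \<Longrightarrow> Dt \<phi> z = 0" "\<And>z. norm z > R \<Longrightarrow> Dx \<phi> z = 0"
proof -
  obtain R where R: "R > 0" "\<And>z. norm z > R \<Longrightarrow> \<phi> z = 0 \<and> Dt \<phi> z = 0 \<and> Dx \<phi> z = 0"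
    using test_fun_support[OF assms] by blast
  obtain B1 where B1: "B1 > 0" "\<And>z. \<bar>\<phi> z\<bar> \<le> B1"
    using continuous_bounded_support[OF test_fun_continuous(1)[OF assms], of R] R(2) by blast
  obtain B2 where B2: "B2 > 0" "\<And>z. \<bar>Dt \<phi> z\<bar> \<le> B2"
    using continuous_bounded_support[OF test_fun_continuous(2)[OF assms], of R] R(2) by blast
  obtain B3 where B3: "B3 > 0" "\<And>z. \<bar>Dx \<phi> z\<bar> \<le> B3"
    using continuous_bounded_support[OF test_fun_continuous(3)[OF assms], of R] R(2) by blast
  show thesis
  proof (rule that[of "B1 + B2 + B3" R])
    show "\<bar>\<phi> z\<bar> \<le> B1 + B2 + B3" for z using B1(1) B2(1) B3(1) B1(2)[of z] by linarith
    show "\<bar>Dt \<phi> z\<bar> \<le> B1 + B2 + B3" for z using B1(1) B2(1) B3(1) B2(2)[of z] by linarith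
    show "\<bar>Dx \<phi> z\<bar> \<le> B1 + B2 + B3" for z using B1(1) B2(1) B3(1) B3(2)[of z] by linarith
  qed (use R B1 B2 B3 in auto)
qed

lemma test_fun_measurable:
  assumes "test_fun \<phi>"
  shows "\<phi> \<in> borel_measurable borel" "Dt \<phi> \<in> borel_measurable borel" "Dx \<phi> \<in> borel_measurable borel"
  using test_fun_continuous[OF assms] by (auto intro: borel_measurable_continuous_onI)

section \<open>Fubini on the plane, and the traces of a test function on the boundary of the quarter
  plane\<close>

lemma LINT_prod_fst:
  fixes f :: "real \<times> real \<Rightarrow> real"
  assumes "integrable lborel f"
  shows "integral\<^sup>L lborel f = (LINT t|lborel. LINT x|lborel. f (t, x))"
    "integrable lborel (\<lambda>t. LINT x|lborel. f (t, x))"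
  using lborel_pair.integral_fst[of "\<lambda>a b. f (a, b)"] lborel_pair.integrable_fst[of "\<lambda>a b. f (a, b)"] assms
  by (simp_all add: lborel_prod)

lemma LINT_prod_snd:
  fixes f :: "real \<times> real \<Rightarrow> real"
  assumes "integrable lborel f"
  shows "integral\<^sup>L lborel f = (LINT x|lborel. LINT t|lborel. f (t, x))"
  using lborel_pair.integral_snd[of "\<lambda>a b. f (a, b)"] assms
  by (simp_all add: lborel_prod)

lemma Omega_measurable [measurable]: "Omega \<in> sets borel"
proof -
  have "Omega = {z. snd z < (0::real)} \<inter> {z. fst z > (0::real)}" by (auto simp: Omega_def)
  also have "\<dots> \<in> sets borel"
    by (intro sets.Int borel_open open_Collect_less continuous_intros)
  finally show ?thesis .
qed

lemma Omega_integrable: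
  fixes f g :: "real \<times> real \<Rightarrow> real"
  assumes "f \<in> borel_measurable borel" "g \<in> borel_measurable borel"
   "\<And>z. z \<in> Omega \<Longrightarrow> \<bar>f z\<bar> \<le> C" "\<And>z. \<bar>g z\<bar> \<le> B" "\<And>z. norm z > R \<Longrightarrow> g z = 0"
  shows "set_integrable lborel Omega (\<lambda>z. f z * g z)"
  unfolding set_integrable_def
proof (rule integrable_bounded_support[where B = "\<bar>C\<bar> * \<bar>B\<bar>" and R = R])
  show "(\<lambda>x. indicator Omega x *\<^sub>R (f x * g x)) \<in> borel_measurable borel"
    using assms(1,2) by measurable
  show "\<bar>indicator Omega z *\<^sub>R (f z * g z)\<bar> \<le> \<bar>C\<bar> * \<bar>B\<bar>" for z
  proof (cases "z \<in> Omega")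
    case True
    then show ?thesis using assms(3)[OF True] assms(4)[of z]
      by (auto simp: abs_mult intro!: mult_mono)
  qed auto
qed (use assms in auto)

text \<open>Integrating in t first, at fixed x < 0, leaves only the initial trace. Together with
  \<open>LINT_Omega_Dx\<close> this is the weak form for constant states.\<close>

lemma LINT_Omega_Dt:
  assumes "test_fun \<phi>"
  shows "(LINT z:Omega|lborel. Dt \<phi> z) = - (LINT x:{..0}|lborel. \<phi> (0, x))"
proof -
  obtain B R where BR: "B > 0" "R > 0" "\<And>z. \<bar>Dt \<phi> z\<bar> \<le> B"
    "\<And>z. norm z > R \<Longrightarrow> \<phi> z = 0" "\<And>z. norm z > R \<Longrightarrow> Dt \<phi> z = 0"
    using test_fun_bounds[OF assms] by metis
  note [measurable] = test_fun_measurable[OF assms]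
  have inner: "(LINT t|lborel. indicator Omega (t, x) *\<^sub>R Dt \<phi> (t, x))
      = - (indicator {..0} x *\<^sub>R \<phi> (0, x))" if "x \<noteq> 0" for x
  proof (cases "x < 0")
    case True
    \<comment> \<open>The support bound is strict, so R + 1 is an end point at which
      \<open>\<phi>\<close> surely vanishes. The two indicators differ at t = 0, a null set.\<close>
    have "(LINT t|lborel. indicator Omega (t, x) *\<^sub>R Dt \<phi> (t, x))
        = (LINT t|lborel. indicator {0..R+1} t *\<^sub>R Dt \<phi> (t, x))"
    proof (rule integral_cong_AE)
      show "AE t in lborel. indicator Omega (t, x) *\<^sub>R Dt \<phi> (t, x) = indicator {0..R+1} t *\<^sub>R Dt \<phi> (t, x)"
        using AE_lborel_singleton[of 0]
      proof eventually_elim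
        case (elim t)
        have "Dt \<phi> (t, x) = 0" if "t > R + 1"
          using BR(5)[of "(t, x)"] norm_fst_le[of t x] that \<open>R > 0\<close> by (auto)
        then show ?case using elim True \<open>R > 0\<close> by (auto simp: indicator_def Omega_def)
      qed
    qed measurable
    also have "\<dots> = (LINT t:{0..R+1}|lborel. Dt \<phi> (t, x))"
      by (simp add: set_lebesgue_integral_def)
    also have "\<dots> = \<phi> (R + 1, x) - \<phi> (0, x)"
    proof (rule LINT_derivative[where S = "{}" and B = B])
      have d: "((\<lambda>t. \<phi> (t, x)) has_real_derivative Dt \<phi> (t, x)) (at t)" for t
        using test_fun_curve_derivative[OF assms, of "\<lambda>t. t" 1 t "\<lambda>_. x" 0] by simp
      then show "continuous_on {0..R + 1} (\<lambda>t. \<phi> (t, x))"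
        by (meson DERIV_continuous_on has_field_derivative_at_within)
      show "\<And>t. t \<in> {0<..<R + 1} - {} \<Longrightarrow> ((\<lambda>t. \<phi> (t, x)) has_real_derivative Dt \<phi> (t, x)) (at t)"
        using d by auto
    qed (use BR in auto)
    also have "\<phi> (R + 1, x) = 0"
      using BR(4)[of "(R + 1, x)"] norm_fst_le[of "R + 1" x] \<open>R > 0\<close> by auto
    finally show ?thesis using True by simp
  qed (use that in \<open>auto simp: Omega_def\<close>)
  have "set_integrable lborel Omega (\<lambda>z. 1 * Dt \<phi> z)"
    by (rule Omega_integrable[where C = 1 and B = B and R = R]) (use BR in auto)
  then have "(LINT z:Omega|lborel. Dt \<phi> z)
      = (LINT x|lborel. LINT t|lborel. indicator Omega (t, x) *\<^sub>R Dt \<phi> (t, x))"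
    unfolding set_lebesgue_integral_def set_integrable_def by (subst LINT_prod_snd) auto
  also have "\<dots> = (LINT x|lborel. - (indicator {..0} x *\<^sub>R \<phi> (0, x)))"
  proof (rule integral_cong_AE)
    show "AE x in lborel. (LINT t|lborel. indicator Omega (t, x) *\<^sub>R Dt \<phi> (t, x))
      = - (indicator {..0} x *\<^sub>R \<phi> (0, x))"
      using AE_lborel_singleton[of 0] by eventually_elim (rule inner)
  qed measurable
  also have "\<dots> = - (LINT x:{..0}|lborel. \<phi> (0, x))"
    by (simp add: set_lebesgue_integral_def)
  finally show ?thesis .
qed

lemma LINT_Omega_Dx:
  assumes "test_fun \<phi>"
  shows "(LINT z:Omega|lborel. Dx \<phi> z) = (LINT t:{0..}|lborel. \<phi> (t, 0))"
proof -
  obtain B R where BR: "B > 0" "R > 0" "\<And>z. \<bar>Dx \<phi> z\<bar> \<le> B"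
    "\<And>z. norm z > R \<Longrightarrow> \<phi> z = 0" "\<And>z. norm z > R \<Longrightarrow> Dx \<phi> z = 0"
    using test_fun_bounds[OF assms] by metis
  note [measurable] = test_fun_measurable[OF assms]
  have inner: "(LINT x|lborel. indicator Omega (t, x) *\<^sub>R Dx \<phi> (t, x))
      = indicator {0..} t *\<^sub>R \<phi> (t, 0)" if "t \<noteq> 0" for t
  proof (cases "t > 0")
    case True
    have "(LINT x|lborel. indicator Omega (t, x) *\<^sub>R Dx \<phi> (t, x))
        = (LINT x|lborel. indicator {-R-1..0} x *\<^sub>R Dx \<phi> (t, x))"
    proof (rule integral_cong_AE)
      show "AE x in lborel. indicator Omega (t, x) *\<^sub>R Dx \<phi> (t, x) = indicator {-R-1..0} x *\<^sub>R Dx \<phi> (t, x)"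
        using AE_lborel_singleton[of 0]
      proof eventually_elim
        case (elim x)
        have "Dx \<phi> (t, x) = 0" if "x < - R - 1"
          using BR(5)[of "(t, x)"] norm_snd_le[of x t] that \<open>R > 0\<close> by auto
        then show ?case using elim True \<open>R > 0\<close> by (auto simp: indicator_def Omega_def)
      qed
    qed measurable
    also have "\<dots> = (LINT x:{-R-1..0}|lborel. Dx \<phi> (t, x))"
      by (simp add: set_lebesgue_integral_def)
    also have "\<dots> = \<phi> (t, 0) - \<phi> (t, -R-1)"
    proof (rule LINT_derivative[where S = "{}" and B = B])
      have d: "((\<lambda>x. \<phi> (t, x)) has_real_derivative Dx \<phi> (t, x)) (at x)" for x
        using test_fun_curve_derivative[OF assms, of "\<lambda>_. t" 0 x "\<lambda>x. x" 1] by simp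
      then show "continuous_on {-R-1..0} (\<lambda>x. \<phi> (t, x))"
        by (meson DERIV_continuous_on has_field_derivative_at_within)
      show "\<And>x. x \<in> {-R-1<..<0} - {} \<Longrightarrow> ((\<lambda>x. \<phi> (t, x)) has_real_derivative Dx \<phi> (t, x)) (at x)"
        using d by auto
    qed (use BR in auto)
    also have "\<phi> (t, -R-1) = 0"
      using BR(4)[of "(t, -R-1)"] norm_snd_le[of "-R-1" t] \<open>R > 0\<close> by auto
    finally show ?thesis using True by simp
  qed (use that in \<open>auto simp: Omega_def\<close>)
  have "set_integrable lborel Omega (\<lambda>z. 1 * Dx \<phi> z)"
    by (rule Omega_integrable[where C = 1 and B = B and R = R]) (use BR in auto)
  then have "(LINT z:Omega|lborel. Dx \<phi> z)
      = (LINT t|lborel. LINT x|lborel. indicator Omega (t, x) *\<^sub>R Dx \<phi> (t, x))"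
    unfolding set_lebesgue_integral_def set_integrable_def by (subst LINT_prod_fst(1)) auto
  also have "\<dots> = (LINT t|lborel. indicator {0..} t *\<^sub>R \<phi> (t, 0))"
  proof (rule integral_cong_AE)
    show "AE t in lborel. (LINT x|lborel. indicator Omega (t, x) *\<^sub>R Dx \<phi> (t, x))
      = indicator {0..} t *\<^sub>R \<phi> (t, 0)"
      using AE_lborel_singleton[of 0] by eventually_elim (rule inner)
  qed measurable
  also have "\<dots> = (LINT t:{0..}|lborel. \<phi> (t, 0))"
    by (simp add: set_lebesgue_integral_def)
  finally show ?thesis .
qed

section \<open>Weak form of self-similar conservation laws\<close>

text \<open>In the coordinates \<open>(t, \<xi>)\<close> with \<open>x = t * \<xi>\<close> the integrand is \<open>f\<close> times \<open>\<partial>\<^sub>t (t \<phi>)\<close>, which integrates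
  to \<open>0\<close> in \<open>t\<close>, plus the \<open>\<xi>\<close>-derivative of \<open>(g - \<xi> * f) * \<phi>\<close>.\<close>
lemma LINT_Omega_sector:
  fixes f g :: "real \<Rightarrow> real"
  assumes \<phi>: "test_fun \<phi>" and a: "a < 0"
    and meas [measurable]: "f \<in> borel_measurable borel" "g \<in> borel_measurable borel"
    and bd: "\<And>\<xi>. \<xi> \<le> 0 \<Longrightarrow> \<bar>f \<xi>\<bar> \<le> C" "\<And>\<xi>. \<xi> \<le> 0 \<Longrightarrow> \<bar>g \<xi>\<bar> \<le> C"
    and zero: "\<And>\<xi>. \<xi> \<le> a \<Longrightarrow> f \<xi> = 0" "\<And>\<xi>. \<xi> \<le> a \<Longrightarrow> g \<xi> = 0"
    and cont: "continuous_on {a..0} (\<lambda>\<xi>. g \<xi> - \<xi> * f \<xi>)" and S: "finite S"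
    and der: "\<And>\<xi>. \<xi> \<in> {a<..<0} - S \<Longrightarrow>
      ((\<lambda>\<xi>. g \<xi> - \<xi> * f \<xi>) has_real_derivative - f \<xi>) (at \<xi>)"
  shows "(LINT z:Omega|lborel. f (snd z / fst z) * Dt \<phi> z + g (snd z / fst z) * Dx \<phi> z)
    = g 0 * (LINT t:{0..}|lborel. \<phi> (t, 0))"
proof -
  obtain B R where BR: "B > 0" "R > 0"
    "\<And>z. \<bar>\<phi> z\<bar> \<le> B" "\<And>z. \<bar>Dt \<phi> z\<bar> \<le> B" "\<And>z. \<bar>Dx \<phi> z\<bar> \<le> B"
    "\<And>z. norm z > R \<Longrightarrow> \<phi> z = 0" "\<And>z. norm z > R \<Longrightarrow> Dt \<phi> z = 0" "\<And>z. norm z > R \<Longrightarrow> Dx \<phi> z = 0"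
    using test_fun_bounds[OF \<phi>] by metis
  note [measurable] = test_fun_measurable[OF \<phi>]
  have C: "C \<ge> 0" using bd(1)[of 0] by auto
  have vanish: "\<phi> (t, y) = 0" "Dt \<phi> (t, y) = 0" "Dx \<phi> (t, y) = 0" if "t > R" for t y
    using BR(6-8)[of "(t, y)"] norm_fst_le[of t y] that by auto
  define h where "h \<xi> = g \<xi> - \<xi> * f \<xi>" for \<xi>
  have h [measurable]: "h \<in> borel_measurable borel" unfolding h_def by measurable
  \<comment> \<open>\<open>\<kappa> (t, \<xi>)\<close> is the t-derivative of
    \<open>t * \<phi> (t, t * \<xi>)\<close>.\<close>
  define \<kappa> where "\<kappa> = (\<lambda>(t, \<xi>). \<phi> (t, t * \<xi>) + t * Dt \<phi> (t, t * \<xi>) + t * \<xi> * Dx \<phi> (t, t * \<xi>))"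
  have \<kappa> [measurable]: "\<kappa> \<in> borel_measurable borel"
    unfolding \<kappa>_def borel_prod[symmetric] split_def by measurable
  have \<kappa>_bd: "\<bar>\<kappa> (t, \<xi>)\<bar> \<le> B + R * B + R * \<bar>a\<bar> * B" if "0 \<le> t" "a \<le> \<xi>" "\<xi> \<le> 0" for t \<xi>
  proof (cases "t \<le> R")
    case True
    have "\<bar>t * Dt \<phi> (t, t * \<xi>)\<bar> \<le> R * B"
      unfolding abs_mult using True that BR by (intro mult_mono) auto
    moreover have "\<bar>t * \<xi> * Dx \<phi> (t, t * \<xi>)\<bar> \<le> R * \<bar>a\<bar> * B"
      unfolding abs_mult using True that BR by (intro mult_mono mult_nonneg_nonneg) auto
    ultimately show ?thesis using BR(3)[of "(t, t * \<xi>)"] unfolding \<kappa>_def by auto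
  next
    case False
    then show ?thesis using BR by (simp add: \<kappa>_def vanish)
  qed
  define K where "K t = (LINT x|lborel. indicator Omega (t, x) *\<^sub>R
     (f (x / t) * Dt \<phi> (t, x) + g (x / t) * Dx \<phi> (t, x)))" for t
  \<comment> \<open>The part of the transformed integrand that will integrate to 0. Confining it to
    the sector gives it bounded support, so both orders of integration are available.\<close>
  define P where "P = (\<lambda>(t, \<xi>). indicator {0..} t * (indicator {a..0} \<xi> * f \<xi> * \<kappa> (t, \<xi>)))"
  have P_meas [measurable]: "P \<in> borel_measurable borel"
    unfolding P_def borel_prod[symmetric] split_def by measurable
  have P_int: "integrable lborel P"
  proof (rule integrable_bounded_support[where B = "C * (B + R * B + R * \<bar>a\<bar> * B)" and R = "R + \<bar>a\<bar>"])
    show "\<bar>P z\<bar> \<le> C * (B + R * B + R * \<bar>a\<bar> * B)" for z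
    proof (cases z)
      case (Pair t \<xi>)
      show ?thesis
      proof (cases "0 \<le> t \<and> a \<le> \<xi> \<and> \<xi> \<le> 0")
        case True
        then have "P z = f \<xi> * \<kappa> (t, \<xi>)" by (simp add: P_def Pair)
        then show ?thesis using True bd(1)[of \<xi>] \<kappa>_bd[of t \<xi>] C
          by (auto simp: abs_mult intro!: mult_mono)
      next
        case False
        then have "P z = 0" by (auto simp: P_def Pair)
        then show ?thesis using C BR by simp
      qed
    qed
    show "P z = 0" if "norm z > R + \<bar>a\<bar>" for z
    proof (cases z)
      case (Pair t \<xi>)
      show ?thesis
      proof (rule ccontr)
        assume "P z \<noteq> 0"
        then have t: "0 \<le> t" and \<xi>: "a \<le> \<xi>" "\<xi> \<le> 0" and "\<kappa> (t, \<xi>) \<noteq> 0"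
          by (auto simp: P_def Pair indicator_def split: if_splits)
        then have "t \<le> R" using vanish[of t] by (force simp: \<kappa>_def)
        moreover have "norm z \<le> \<bar>t\<bar> + \<bar>\<xi>\<bar>" unfolding Pair using norm_Pair_le[of t \<xi>] by simp
        ultimately show False using that t \<xi> by auto
      qed
    qed
  qed measurable
  have K: "K t = indicator {0..} t * (g 0 * \<phi> (t, 0)) + (LINT \<xi>|lborel. P (t, \<xi>))" if "t \<noteq> 0" for t
  proof (cases "t > 0")
    case t: True
    \<comment> \<open>Off \<open>S\<close>, where h' = - f, this is the \<xi>-derivative of
      \<open>h \<xi> * \<phi> (t, t * \<xi>)\<close>.\<close>
    let ?q = "\<lambda>\<xi>. h \<xi> * (t * Dx \<phi> (t, t * \<xi>)) - f \<xi> * \<phi> (t, t * \<xi>)"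
    have hC: "\<bar>h \<xi>\<bar> \<le> C + \<bar>a\<bar> * C" if "\<xi> \<in> {a..0}" for \<xi>
    proof -
      have "\<bar>\<xi> * f \<xi>\<bar> \<le> \<bar>a\<bar> * C" unfolding abs_mult using that bd(1)[of \<xi>] by (intro mult_mono) auto
      then show ?thesis using that bd(2)[of \<xi>] unfolding h_def by auto
    qed
    have q_bd: "\<bar>?q \<xi>\<bar> \<le> (C + \<bar>a\<bar> * C) * (t * B) + C * B" if \<xi>: "\<xi> \<in> {a..0}" for \<xi>
    proof -
      have "\<bar>h \<xi> * (t * Dx \<phi> (t, t * \<xi>))\<bar> \<le> (C + \<bar>a\<bar> * C) * (t * B)"
        unfolding abs_mult[of "h \<xi>"] using hC[OF \<xi>] C t BR(5)
        by (intro mult_mono) (auto simp: abs_mult)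
      moreover have "\<bar>f \<xi> * \<phi> (t, t * \<xi>)\<bar> \<le> C * B"
        unfolding abs_mult using bd(1)[of \<xi>] \<xi> C BR(3) by (intro mult_mono) auto
      ultimately show ?thesis by linarith
    qed
    have q_meas [measurable]: "?q \<in> borel_measurable borel" by measurable
    have q: "(LINT \<xi>:{a..0}|lborel. ?q \<xi>) = g 0 * \<phi> (t, 0)"
    proof -
      have d: "((\<lambda>\<xi>. \<phi> (t, t * \<xi>)) has_real_derivative t * Dx \<phi> (t, t * \<xi>)) (at \<xi>)" for \<xi>
        using test_fun_curve_derivative[OF \<phi>, of "\<lambda>_. t" 0 \<xi> "\<lambda>\<xi>. t * \<xi>" t]
        by (auto intro!: derivative_eq_intros)
      have "(LINT \<xi>:{a..0}|lborel. ?q \<xi>) = h 0 * \<phi> (t, t * 0) - h a * \<phi> (t, t * a)"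
      proof (rule LINT_derivative[OF _ _ S])
        show "continuous_on {a..0} (\<lambda>\<xi>. h \<xi> * \<phi> (t, t * \<xi>))"
          unfolding h_def
          by (intro continuous_on_mult[OF cont] DERIV_continuous_on[OF has_field_derivative_at_within[OF d]])
        show "((\<lambda>\<xi>. h \<xi> * \<phi> (t, t * \<xi>)) has_real_derivative ?q \<xi>) (at \<xi>)"
          if "\<xi> \<in> {a<..<0} - S" for \<xi>
          using DERIV_mult[OF der[OF that, folded h_def] d[of \<xi>]] by (simp add: algebra_simps)
      qed (use a q_bd in auto)
      then show ?thesis using zero[of a] by (simp add: h_def)
    qed
    have "K t = t * (LINT \<xi>|lborel. indicator Omega (t, t * \<xi>) *\<^sub>R
     (f \<xi> * Dt \<phi> (t, t * \<xi>) + g \<xi> * Dx \<phi> (t, t * \<xi>)))"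
      unfolding K_def using t
      by (subst lborel_integral_real_affine[where c = t and t = 0]) auto
    also have "\<dots> = (LINT \<xi>|lborel. t * (indicator Omega (t, t * \<xi>) *\<^sub>R
     (f \<xi> * Dt \<phi> (t, t * \<xi>) + g \<xi> * Dx \<phi> (t, t * \<xi>))))"
      by simp
    \<comment> \<open>Pointwise, \<open>f * \<phi>\<close> and
      \<open>t * \<xi> * f * Dx \<phi>\<close> are added and subtracted; the factor t is the
      Jacobian of x = t * \<xi>.\<close>
    also have "\<dots> = (LINT \<xi>|lborel. indicator {a..0} \<xi> *\<^sub>R ?q \<xi> + P (t, \<xi>))"
    proof (rule integral_cong_AE)
      show "AE \<xi> in lborel. t * (indicator Omega (t, t * \<xi>) *\<^sub>R
     (f \<xi> * Dt \<phi> (t, t * \<xi>) + g \<xi> * Dx \<phi> (t, t * \<xi>))) = indicator {a..0} \<xi> *\<^sub>R ?q \<xi> + P (t, \<xi>)"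
        using AE_lborel_singleton[of 0]
      proof eventually_elim
        case (elim \<xi>)
        consider "\<xi> > 0" | "\<xi> \<in> {a..<0}" | "\<xi> < a" using elim a by fastforce
        then show ?case
        proof cases
          case 1
          then show ?thesis using t by (auto simp: Omega_def P_def mult_less_0_iff)
        next
          case 2
          then have "(t, t * \<xi>) \<in> Omega" using t by (auto simp: Omega_def mult_less_0_iff)
          then show ?thesis using 2 t by (auto simp: P_def \<kappa>_def h_def algebra_simps)
        next
          case 3
          then show ?thesis using t a zero by (auto simp: P_def)
        qed
      qed
    next
      show "(\<lambda>\<xi>. t * (indicator Omega (t, t * \<xi>) *\<^sub>R
        (f \<xi> * Dt \<phi> (t, t * \<xi>) + g \<xi> * Dx \<phi> (t, t * \<xi>)))) \<in> borel_measurable lborel" by measurable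
      show "(\<lambda>\<xi>. indicator {a..0} \<xi> *\<^sub>R ?q \<xi> + P (t, \<xi>)) \<in> borel_measurable lborel" by measurable
    qed
    also have "\<dots> = (LINT \<xi>|lborel. indicator {a..0} \<xi> *\<^sub>R ?q \<xi>) + (LINT \<xi>|lborel. P (t, \<xi>))"
    proof (rule Bochner_Integration.integral_add)
      show "integrable lborel (\<lambda>\<xi>. indicator {a..0} \<xi> *\<^sub>R ?q \<xi>)"
      proof (rule integrable_bounded_support[where B = "(C + \<bar>a\<bar> * C) * (t * B) + C * B" and R = "\<bar>a\<bar>"])
        show "\<bar>indicator {a..0} \<xi> *\<^sub>R ?q \<xi>\<bar> \<le> (C + \<bar>a\<bar> * C) * (t * B) + C * B" for \<xi>
          using q_bd[of \<xi>] C BR t by (auto simp: indicator_def)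
      qed (auto simp: indicator_def)
      show "integrable lborel (\<lambda>\<xi>. P (t, \<xi>))"
      proof (rule integrable_bounded_support[where B = "C * (B + R * B + R * \<bar>a\<bar> * B)" and R = "\<bar>a\<bar>"])
        show "\<bar>P (t, \<xi>)\<bar> \<le> C * (B + R * B + R * \<bar>a\<bar> * B)" for \<xi>
          using bd(1)[of \<xi>] \<kappa>_bd[of t \<xi>] C BR t
          by (auto simp: P_def indicator_def abs_mult intro!: mult_mono)
      qed (auto simp: P_def indicator_def)
    qed
    also have "(LINT \<xi>|lborel. indicator {a..0} \<xi> *\<^sub>R ?q \<xi>) = g 0 * \<phi> (t, 0)"
      using q by (simp add: set_lebesgue_integral_def)
    finally show ?thesis using t by simp
  qed (use that in \<open>auto simp: K_def P_def Omega_def\<close>)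
  \<comment> \<open>The primitive \<open>t * \<phi> (t, t * \<xi>)\<close> vanishes at t = 0 by its
    factor t and at t = R + 1 by the support of \<open>\<phi>\<close>.\<close>
  have P0: "(LINT t|lborel. P (t, \<xi>)) = 0" for \<xi>
  proof (cases "a \<le> \<xi> \<and> \<xi> \<le> 0")
    case True
    have "(LINT t|lborel. P (t, \<xi>)) = (LINT t|lborel. f \<xi> * (indicator {0..R+1} t *\<^sub>R \<kappa> (t, \<xi>)))"
      using True BR(2) vanish
      by (intro Bochner_Integration.integral_cong) (auto simp: P_def indicator_def \<kappa>_def)
    also have "\<dots> = f \<xi> * (LINT t:{0..R+1}|lborel. \<kappa> (t, \<xi>))"
      by (simp add: set_lebesgue_integral_def)
    also have "(LINT t:{0..R+1}|lborel. \<kappa> (t, \<xi>)) = (R + 1) * \<phi> (R + 1, (R + 1) * \<xi>) - 0 * \<phi> (0, 0 * \<xi>)"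
    proof (rule LINT_derivative[where S = "{}"])
      have d: "((\<lambda>t. t * \<phi> (t, t * \<xi>)) has_real_derivative \<kappa> (t, \<xi>)) (at t)" for t
      proof -
        have "((\<lambda>t. \<phi> (t, t * \<xi>)) has_real_derivative 1 * Dt \<phi> (t, t * \<xi>) + \<xi> * Dx \<phi> (t, t * \<xi>)) (at t)"
          by (rule test_fun_curve_derivative[OF \<phi>]) (auto intro!: derivative_eq_intros)
        from DERIV_mult[OF DERIV_ident this] show ?thesis
          by (simp add: \<kappa>_def algebra_simps)
      qed
      show "continuous_on {0..R + 1} (\<lambda>t. t * \<phi> (t, t * \<xi>))"
        by (rule DERIV_continuous_on[OF has_field_derivative_at_within[OF d]])
      show "\<And>t. t \<in> {0<..<R + 1} - {} \<Longrightarrow> ((\<lambda>t. t * \<phi> (t, t * \<xi>)) has_real_derivative \<kappa> (t, \<xi>)) (at t)"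
        using d by auto
      show "\<And>t. t \<in> {0..R + 1} \<Longrightarrow> \<bar>\<kappa> (t, \<xi>)\<bar> \<le> B + R * B + R * \<bar>a\<bar> * B"
        using \<kappa>_bd True by auto
    qed (use BR in auto)
    also have "\<dots> = 0" using vanish(1)[of "R + 1"] by simp
    finally show ?thesis by simp
  next
    case False
    then have "P (t, \<xi>) = 0" for t by (auto simp: P_def)
    then show ?thesis by simp
  qed
  have sets: "set_integrable lborel Omega (\<lambda>z. f (snd z / fst z) * Dt \<phi> z)"
    "set_integrable lborel Omega (\<lambda>z. g (snd z / fst z) * Dx \<phi> z)"
  proof -
    have *: "snd z / fst z \<le> 0" if "z \<in> Omega" for z
      using that by (auto simp: Omega_def divide_le_0_iff)
    have m: "(\<lambda>z. q (snd z / fst z)) \<in> borel_measurable borel"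
      if [measurable]: "q \<in> borel_measurable borel" for q :: "real \<Rightarrow> real"
      unfolding borel_prod[symmetric] by measurable
    show "set_integrable lborel Omega (\<lambda>z. f (snd z / fst z) * Dt \<phi> z)"
      by (rule Omega_integrable[where C = C and B = B and R = R, OF m])
        (use BR bd * in auto)
    show "set_integrable lborel Omega (\<lambda>z. g (snd z / fst z) * Dx \<phi> z)"
      by (rule Omega_integrable[where C = C and B = B and R = R, OF m])
        (use BR bd * in auto)
  qed
  have "(LINT z:Omega|lborel. f (snd z / fst z) * Dt \<phi> z + g (snd z / fst z) * Dx \<phi> z)
     = (LINT t|lborel. K t)"
    using LINT_prod_fst(1)[OF set_integral_add(1)[OF sets, unfolded set_integrable_def]]
    by (simp add: set_lebesgue_integral_def K_def)
  also have "\<dots> = (LINT t|lborel. indicator {0..} t * (g 0 * \<phi> (t, 0)) + (LINT \<xi>|lborel. P (t, \<xi>)))"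
  proof (rule integral_cong_AE)
    show "AE t in lborel. K t = indicator {0..} t * (g 0 * \<phi> (t, 0)) + (LINT \<xi>|lborel. P (t, \<xi>))"
      using AE_lborel_singleton[of 0] by eventually_elim (rule K)
    have "integrable lborel K"
      using LINT_prod_fst(2)[OF set_integral_add(1)[OF sets, unfolded set_integrable_def]]
      by (simp add: K_def[abs_def])
    then show "K \<in> borel_measurable lborel" by (rule borel_measurable_integrable)
    have [measurable]: "(\<lambda>t. LINT \<xi>|lborel. P (t, \<xi>)) \<in> borel_measurable lborel"
      using LINT_prod_fst(2)[OF P_int] by (rule borel_measurable_integrable)
    show "(\<lambda>t. indicator {0..} t * (g 0 * \<phi> (t, 0)) + (LINT \<xi>|lborel. P (t, \<xi>))) \<in> borel_measurable lborel"
      by measurable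
  qed
  also have "\<dots> = (LINT t|lborel. indicator {0..} t * (g 0 * \<phi> (t, 0)))
      + (LINT t|lborel. LINT \<xi>|lborel. P (t, \<xi>))"
  proof (rule Bochner_Integration.integral_add)
    show "integrable lborel (\<lambda>t. indicator {0..} t * (g 0 * \<phi> (t, 0)))"
    proof (rule integrable_bounded_support[where B = "\<bar>g 0\<bar> * B" and R = R])
      show "\<bar>indicator {0..} t * (g 0 * \<phi> (t, 0))\<bar> \<le> \<bar>g 0\<bar> * B" for t
        using BR(1) BR(3)[of "(t, 0)"] by (auto simp: indicator_def abs_mult intro!: mult_left_mono)
      show "indicator {0..} t * (g 0 * \<phi> (t, 0)) = 0" if "norm t > R" for t :: real
        using that vanish[of t 0] by (auto simp: indicator_def)
    qed measurable
  qed (rule LINT_prod_fst(2)[OF P_int])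
  \<comment> \<open>\<open>P0\<close> integrates in t at fixed \<xi>, so the order of integration
    has to be swapped.\<close>
  also have "(LINT t|lborel. LINT \<xi>|lborel. P (t, \<xi>)) = 0"
    using LINT_prod_fst(1)[OF P_int] LINT_prod_snd[OF P_int] P0 by simp
  also have "(LINT t|lborel. indicator {0..} t * (g 0 * \<phi> (t, 0))) = g 0 * (LINT t:{0..}|lborel. \<phi> (t, 0))"
    by (simp add: set_lebesgue_integral_def mult.left_commute[of _ "g 0"])
  finally show ?thesis by simp
qed

text \<open>Near t = 0 the support of \<open>\<phi>\<close> is unbounded in the coordinate \<xi>, so
  the sector identity needs data vanishing for \<xi> \<le> a. Subtracting the left state achieves
  this and preserves the ODE, since (G0 - \<xi> * F0)' = - F0. The subtracted constants contribute
  the traces on t = 0 and x = 0.\<close>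

lemma self_similar_weak_identity:
  fixes F G :: "real \<Rightarrow> real"
  assumes \<phi>: "test_fun \<phi>" and a: "a < 0"
    and meas: "F \<in> borel_measurable borel" "G \<in> borel_measurable borel"
    and bd: "\<And>\<xi>. \<xi> \<le> 0 \<Longrightarrow> \<bar>F \<xi>\<bar> \<le> C" "\<And>\<xi>. \<xi> \<le> 0 \<Longrightarrow> \<bar>G \<xi>\<bar> \<le> C"
    and left: "\<And>\<xi>. \<xi> \<le> a \<Longrightarrow> F \<xi> = F0" "\<And>\<xi>. \<xi> \<le> a \<Longrightarrow> G \<xi> = G0"
    and cont: "continuous_on {a..0} (\<lambda>\<xi>. G \<xi> - \<xi> * F \<xi>)" and S: "finite S"
    and der: "\<And>\<xi>. \<xi> \<in> {a<..<0} - S \<Longrightarrow>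
      ((\<lambda>\<xi>. G \<xi> - \<xi> * F \<xi>) has_real_derivative - F \<xi>) (at \<xi>)"
  shows "(LINT z:Omega|lborel. F (snd z / fst z) * Dt \<phi> z + G (snd z / fst z) * Dx \<phi> z)
    + F0 * (LINT x:{..0}|lborel. \<phi> (0, x)) - G 0 * (LINT t:{0..}|lborel. \<phi> (t, 0)) = 0"
proof -
  obtain B R where BR: "B > 0" "R > 0"
    "\<And>z. \<bar>\<phi> z\<bar> \<le> B" "\<And>z. \<bar>Dt \<phi> z\<bar> \<le> B" "\<And>z. \<bar>Dx \<phi> z\<bar> \<le> B"
    "\<And>z. norm z > R \<Longrightarrow> \<phi> z = 0" "\<And>z. norm z > R \<Longrightarrow> Dt \<phi> z = 0" "\<And>z. norm z > R \<Longrightarrow> Dx \<phi> z = 0"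
    using test_fun_bounds[OF \<phi>] by metis
  note \<phi>_meas = test_fun_measurable[OF \<phi>]
  have bd0: "\<bar>F0\<bar> \<le> C" "\<bar>G0\<bar> \<le> C" using bd[of a] left[of a] a by auto
  have *: "snd z / fst z \<le> 0" if "z \<in> Omega" for z
    using that by (auto simp: Omega_def divide_le_0_iff)
  have m: "(\<lambda>z. q (snd z / fst z) - q0) \<in> borel_measurable borel"
    if [measurable]: "q \<in> borel_measurable borel" for q :: "real \<Rightarrow> real" and q0
    unfolding borel_prod[symmetric] by measurable
  have bd': "\<bar>F \<xi> - F0\<bar> \<le> 2 * C" "\<bar>G \<xi> - G0\<bar> \<le> 2 * C" if "\<xi> \<le> 0" for \<xi>
    using bd[OF that] bd0 by linarith+
  have "set_integrable lborel Omega (\<lambda>z. (F (snd z / fst z) - F0) * Dt \<phi> z)"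
    by (rule Omega_integrable[where C = "2 * C" and B = B and R = R, OF m[OF meas(1)]])
      (use BR bd' \<phi>_meas * in auto)
  moreover have "set_integrable lborel Omega (\<lambda>z. (G (snd z / fst z) - G0) * Dx \<phi> z)"
    by (rule Omega_integrable[where C = "2 * C" and B = B and R = R, OF m[OF meas(2)]])
      (use BR bd' \<phi>_meas * in auto)
  moreover have "set_integrable lborel Omega (\<lambda>z. F0 * Dt \<phi> z)" "set_integrable lborel Omega (\<lambda>z. G0 * Dx \<phi> z)"
    by (rule Omega_integrable[where C = C and B = B and R = R]; use BR bd0 \<phi>_meas in auto)+
  ultimately have sets: "set_integrable lborel Omega (\<lambda>z. (F (snd z / fst z) - F0) * Dt \<phi> z)"
    "set_integrable lborel Omega (\<lambda>z. (G (snd z / fst z) - G0) * Dx \<phi> z)"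
    "set_integrable lborel Omega (\<lambda>z. F0 * Dt \<phi> z)" "set_integrable lborel Omega (\<lambda>z. G0 * Dx \<phi> z)" .
  have "(LINT z:Omega|lborel. F (snd z / fst z) * Dt \<phi> z + G (snd z / fst z) * Dx \<phi> z)
    = (LINT z:Omega|lborel. ((F (snd z / fst z) - F0) * Dt \<phi> z + (G (snd z / fst z) - G0) * Dx \<phi> z)
        + (F0 * Dt \<phi> z + G0 * Dx \<phi> z))"
    by (simp add: algebra_simps)
  also have "\<dots> = (LINT z:Omega|lborel. (F (snd z / fst z) - F0) * Dt \<phi> z + (G (snd z / fst z) - G0) * Dx \<phi> z)
      + ((LINT z:Omega|lborel. F0 * Dt \<phi> z) + (LINT z:Omega|lborel. G0 * Dx \<phi> z))"
    using sets by (simp add: set_integral_add)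
  also have "(LINT z:Omega|lborel. (F (snd z / fst z) - F0) * Dt \<phi> z + (G (snd z / fst z) - G0) * Dx \<phi> z)
     = (G 0 - G0) * (LINT t:{0..}|lborel. \<phi> (t, 0))"
  proof (rule LINT_Omega_sector[OF \<phi> a, where C = "2 * C", OF _ _ _ _ _ _ _ S])
    have "continuous_on {a..0} (\<lambda>\<xi>. (G \<xi> - \<xi> * F \<xi>) - (G0 - \<xi> * F0))"
      by (intro continuous_on_diff[OF cont] continuous_intros)
    then show "continuous_on {a..0} (\<lambda>\<xi>. (G \<xi> - G0) - \<xi> * (F \<xi> - F0))"
      by (simp add: algebra_simps)
    show "((\<lambda>\<xi>. (G \<xi> - G0) - \<xi> * (F \<xi> - F0)) has_real_derivative - (F \<xi> - F0)) (at \<xi>)"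
      if "\<xi> \<in> {a<..<0} - S" for \<xi>
    proof -
      have "((\<lambda>\<xi>. (G \<xi> - \<xi> * F \<xi>) - (G0 - \<xi> * F0)) has_real_derivative - F \<xi> - (0 - F0)) (at \<xi>)"
        by (rule DERIV_diff[OF der[OF that]]) (auto intro!: derivative_eq_intros)
      then show ?thesis by (simp add: algebra_simps)
    qed
  qed (use bd' left meas in auto)
  also have "(LINT z:Omega|lborel. F0 * Dt \<phi> z) = F0 * - (LINT x:{..0}|lborel. \<phi> (0, x))"
    using LINT_Omega_Dt[OF \<phi>] by simp
  also have "(LINT z:Omega|lborel. G0 * Dx \<phi> z) = G0 * (LINT t:{0..}|lborel. \<phi> (t, 0))"
    using LINT_Omega_Dx[OF \<phi>] by simp
  finally show ?thesis by (simp add: algebra_simps)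
qed

section \<open>The explicit rarefaction fan\<close>

locale piston =
  fixes \<gamma> E0 :: real
  assumes gamma: "\<gamma> > 1" and energy: "E0 > 1/2"
begin

text \<open>\<open>s\<close> is the initial sound speed, and \<open>w = \<rho> powr (1 / q)\<close> is the sound speed in units of \<open>s\<close>. The
  whole fan is a function of \<open>w\<close>, which is affine in \<open>x / t\<close> there; at the piston it equals
  \<open>w1\<close>, and \<open>w1 = 0\<close> is the vacuum.\<close>

definition s :: real where "s = 1 / mach \<gamma> E0"
definition q :: real where "q = 2 / (\<gamma> - 1)"
definition \<xi>L :: real where "\<xi>L = - 1 - s"
text \<open>The fan ends at whichever comes first: rest, at \<xi> = u - c = 1 / q - s with u = 0, or
  vacuum, at \<xi> = u = q * s - 1 with c = 0.\<close>

definition \<xi>R :: real where "\<xi>R = min (1 / q - s) (q * s - 1)"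
text \<open>\<open>1 - 1 / (q * s)\<close> is the root of \<open>uw\<close>, where the gas comes to
  rest. If it is negative, the density reaches 0 before that.\<close>

definition w1 :: real where "w1 = max 0 (1 - 1 / (q * s))"
text \<open>The affine expression solves \<open>uw w - s * w = \<xi>\<close> for w; the clamps
  attach the two constant states.\<close>

definition wave :: "real \<Rightarrow> real" where
  "wave \<xi> = max w1 (min 1 (1 - (1 + \<xi> + s) / ((q + 1) * s)))"
text \<open>Constancy of the Riemann invariant u + 2 * c / (\<gamma> - 1), with sound speed c = s *
  w and initial value q * s - 1.\<close>

definition uw :: "real \<Rightarrow> real" where "uw w = -1 + q * s * (1 - w)"
text \<open>Kinetic plus internal energy: the latter starts at E0 - 1/2 and scales with the square
  of the sound speed.\<close>

definition ew :: "real \<Rightarrow> real" where "ew w = (uw w)\<^sup>2 / 2 + (E0 - 1/2) * w\<^sup>2"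
definition fan :: "real \<Rightarrow> state" where
  "fan \<xi> = (wave \<xi> powr q, uw (wave \<xi>), ew (wave \<xi>))"

section \<open>Algebra of the constants and bounds on the fan\<close>

lemma s_eq: "s = sqrt (\<gamma> * (\<gamma> - 1) * (E0 - 1/2))"
  by (simp add: s_def mach_def)

lemma s_pos: "s > 0" and q_pos: "q > 0"
  using gamma energy by (auto simp: s_eq q_def)

lemma gamma_q: "(\<gamma> - 1) * q = 2" "\<gamma> * q = q + 2"
proof -
  show "(\<gamma> - 1) * q = 2" using gamma unfolding q_def by (metis eq_iff_diff_eq_0 less_irrefl nonzero_mult_div_cancel_left times_divide_eq_right)
  then show "\<gamma> * q = q + 2" by (simp add: algebra_simps)
qed

lemma s_square: "s\<^sup>2 = \<gamma> * (\<gamma> - 1) * (E0 - 1/2)"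
  using gamma energy by (simp add: s_eq)

text \<open>The initial pressure at unit density is the squared sound speed divided by \<gamma>, and
  \<gamma> = (q + 2) / q.\<close>

lemma pressure_coeff: "(\<gamma> - 1) * (E0 - 1/2) = q * s\<^sup>2 / (q + 2)"
proof -
  have "q * s\<^sup>2 = (\<gamma> * q) * ((\<gamma> - 1) * (E0 - 1/2))" by (simp add: s_square)
  then show ?thesis using q_pos by (simp add: gamma_q(2))
qed

lemma energy_coeff: "E0 - 1/2 = q\<^sup>2 * s\<^sup>2 / (2 * (q + 2))"
proof -
  have "2 * (E0 - 1/2) = q * ((\<gamma> - 1) * (E0 - 1/2))" by (simp only: gamma_q(1)[symmetric] ac_simps)
  then show ?thesis unfolding pressure_coeff using q_pos by (simp add: field_simps power2_eq_square)
qed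

lemma w1_bounds: "0 \<le> w1" "w1 < 1"
  using s_pos q_pos by (auto simp: w1_def)

lemma \<xi>R_cases:
  "q * s \<ge> 1 \<Longrightarrow> \<xi>R = 1 / q - s" "q * s \<le> 1 \<Longrightarrow> \<xi>R = q * s - 1"
proof -
  have d: "1 / q - s = (1 - q * s) / q" using q_pos by (simp add: field_simps)
  show "\<xi>R = 1 / q - s" if "q * s \<ge> 1"
  proof -
    have "(1 - q * s) / q \<le> 0" using that q_pos by (simp add: divide_le_0_iff)
    then show ?thesis using that d by (simp add: \<xi>R_def)
  qed
  show "\<xi>R = q * s - 1" if "q * s \<le> 1"
  proof -
    have "(1 - q * s) / q \<ge> 0" using that q_pos by simp
    then show ?thesis using that d by (simp add: \<xi>R_def)
  qed
qed

text \<open>Here \<open>\<xi>R\<close> appears as the point where the affine profile reaches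
  \<open>w1\<close>, which treats rest and vacuum alike.\<close>

lemma \<xi>R_alt: "\<xi>R = q * s - 1 - (q + 1) * s * w1"
proof (cases "q * s \<ge> 1")
  case True
  then have "w1 = 1 - 1 / (q * s)" by (simp add: w1_def)
  moreover have "(q + 1) * s * (1 - 1 / (q * s)) = q * s + s - 1 - 1 / q"
    using s_pos q_pos by (simp add: field_simps)
  ultimately show ?thesis using True by (simp add: \<xi>R_cases)
next
  case False
  then have "w1 = 0" using s_pos q_pos by (simp add: w1_def field_simps)
  then show ?thesis using False by (simp add: \<xi>R_cases)
qed

lemma denom_pos: "(q + 1) * s > 0"
  using s_pos q_pos by simp

lemma \<xi>L_less_\<xi>R: "\<xi>L < \<xi>R"
proof -
  have "(q + 1) * s * w1 < (q + 1) * s * 1"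
    using w1_bounds s_pos q_pos by (intro mult_strict_left_mono) auto
  then show ?thesis by (simp add: \<xi>R_alt \<xi>L_def algebra_simps)
qed

lemma \<xi>L_neg: "\<xi>L < 0"
  using s_pos by (simp add: \<xi>L_def)

lemma \<xi>R_nonpos: "\<xi>R \<le> 0"
  unfolding \<xi>R_def using s_pos q_pos
  by (cases "q * s \<ge> 1") (auto simp: min_le_iff_disj field_simps)

lemma wave_left: "\<xi> \<le> \<xi>L \<Longrightarrow> wave \<xi> = 1"
  using w1_bounds s_pos q_pos by (simp add: wave_def \<xi>L_def divide_le_0_iff min_absorb1)

lemma wave_mid:
  assumes "\<xi>L \<le> \<xi>" "\<xi> \<le> \<xi>R"
  shows "wave \<xi> = 1 - (1 + \<xi> + s) / ((q + 1) * s)"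
proof -
  have "(1 + \<xi> + s) / ((q + 1) * s) \<ge> 0"
    using assms s_pos q_pos by (simp add: \<xi>L_def)
  moreover have "(1 + \<xi> + s) / ((q + 1) * s) \<le> 1 - w1"
    unfolding pos_divide_le_eq[OF denom_pos] using assms by (simp add: \<xi>R_alt algebra_simps)
  ultimately show ?thesis by (simp add: wave_def)
qed

lemma wave_right:
  assumes "\<xi>R \<le> \<xi>"
  shows "wave \<xi> = w1"
proof -
  have "(1 + \<xi> + s) / ((q + 1) * s) \<ge> 1 - w1"
    unfolding pos_le_divide_eq[OF denom_pos] using assms by (simp add: \<xi>R_alt algebra_simps)
  then show ?thesis using w1_bounds by (simp add: wave_def)
qed

lemma wave_bounds: "w1 \<le> wave \<xi>" "wave \<xi> \<le> 1"
  using w1_bounds by (auto simp: wave_def)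

lemma wave_nonneg: "0 \<le> wave \<xi>"
  using wave_bounds(1) w1_bounds(1) by (rule order_trans[rotated])

lemma wave_mid_bounds:
  assumes "\<xi>L < \<xi>" "\<xi> < \<xi>R"
  shows "w1 < wave \<xi>" "wave \<xi> < 1" "0 < wave \<xi>"
proof -
  have "(1 + \<xi> + s) / ((q + 1) * s) > 0"
    using assms s_pos q_pos by (simp add: \<xi>L_def)
  moreover have "(1 + \<xi> + s) / ((q + 1) * s) < 1 - w1"
    unfolding pos_divide_less_eq[OF denom_pos] using assms by (simp add: \<xi>R_alt algebra_simps)
  ultimately show "w1 < wave \<xi>" "wave \<xi> < 1"
    using wave_mid[of \<xi>] assms by auto
  then show "0 < wave \<xi>" using w1_bounds by linarith
qed

lemma wave_characteristic:
  assumes "\<xi>L \<le> \<xi>" "\<xi> \<le> \<xi>R"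
  shows "uw (wave \<xi>) - s * wave \<xi> = \<xi>"
proof -
  define Z where "Z = (1 + \<xi> + s) / ((q + 1) * s)"
  have "((q + 1) * s) * Z = 1 + \<xi> + s"
    unfolding Z_def using denom_pos by (metis less_irrefl nonzero_mult_div_cancel_left times_divide_eq_right)
  then show ?thesis
    unfolding wave_mid[OF assms, folded Z_def] uw_def by (simp add: algebra_simps)
qed

lemma wave_continuous: "continuous_on A wave"
  unfolding wave_def by (intro continuous_intros) (use s_pos q_pos in auto)

lemma uw_bounds:
  assumes "w1 \<le> w" "w \<le> 1"
  shows "- 1 \<le> uw w" "uw w \<le> 0"
proof -
  have "1 - w \<le> 1 / (q * s)" using assms(1) by (simp add: w1_def)
  then have "q * s * (1 - w) \<le> q * s * (1 / (q * s))"
    using s_pos q_pos by (intro mult_left_mono) auto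
  then show "uw w \<le> 0" using s_pos q_pos by (simp add: uw_def)
  show "- 1 \<le> uw w" using assms(2) s_pos q_pos by (simp add: uw_def)
qed

lemma uw_square_le: "w1 \<le> w \<Longrightarrow> w \<le> 1 \<Longrightarrow> (uw w)\<^sup>2 \<le> 1"
  using uw_bounds[of w] by (simp add: abs_square_le_1)

lemma ew_bounds:
  assumes "w1 \<le> w" "w \<le> 1"
  shows "0 \<le> ew w" "ew w \<le> E0"
proof -
  have "w\<^sup>2 \<le> 1" using assms w1_bounds by (simp add: power_le_one)
  then have "(E0 - 1/2) * w\<^sup>2 \<le> (E0 - 1/2) * 1"
    using energy by (intro mult_left_mono) auto
  moreover have "(uw w)\<^sup>2 / 2 \<le> 1 / 2" using uw_square_le[OF assms] by simp
  ultimately show "ew w \<le> E0" unfolding ew_def by simp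
  show "0 \<le> ew w" using energy by (simp add: ew_def)
qed

lemma rho_bounds: "0 \<le> wave \<xi> powr q" "wave \<xi> powr q \<le> 1"
  using wave_bounds(2)[of \<xi>] wave_nonneg[of \<xi>] q_pos by (auto intro: powr_le1)

lemma pres_state: "pres \<gamma> (\<rho>, uw w, ew w) = (\<gamma> - 1) * (E0 - 1/2) * \<rho> * w\<^sup>2"
  by (simp add: pres_def dens_def vel_def energy_def ew_def)

lemma pres_fan: "pres \<gamma> (fan \<xi>) = (\<gamma> - 1) * (E0 - 1/2) * wave \<xi> powr q * (wave \<xi>)\<^sup>2"
  by (simp add: fan_def pres_state)

lemma fan_simps: "dens (fan \<xi>) = wave \<xi> powr q" "vel (fan \<xi>) = uw (wave \<xi>)"
  "energy (fan \<xi>) = ew (wave \<xi>)"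
  by (simp_all add: fan_def dens_def vel_def energy_def)

lemma pres_fan_bounds: "0 \<le> pres \<gamma> (fan \<xi>)" "pres \<gamma> (fan \<xi>) \<le> (\<gamma> - 1) * (E0 - 1/2)"
proof -
  have "wave \<xi> powr q * (wave \<xi>)\<^sup>2 \<le> 1 * 1"
    using rho_bounds[of \<xi>] wave_bounds[of \<xi>] wave_nonneg[of \<xi>]
    by (intro mult_mono power_le_one) auto
  then have "(\<gamma> - 1) * (E0 - 1/2) * (wave \<xi> powr q * (wave \<xi>)\<^sup>2) \<le> (\<gamma> - 1) * (E0 - 1/2) * 1"
    using gamma energy by (intro mult_left_mono) auto
  then show "pres \<gamma> (fan \<xi>) \<le> (\<gamma> - 1) * (E0 - 1/2)" by (simp add: pres_fan mult.assoc)
  show "0 \<le> pres \<gamma> (fan \<xi>)" using gamma energy by (simp add: pres_fan)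
qed

lemma fan_left: "\<xi> \<le> \<xi>L \<Longrightarrow> fan \<xi> = (1, -1, E0)"
  by (simp add: fan_def wave_left uw_def ew_def)

lemma fan_continuous: "continuous_on UNIV fan"
proof -
  have "continuous_on UNIV (\<lambda>\<xi>. wave \<xi> powr q)"
    using wave_continuous wave_nonneg q_pos by (intro continuous_on_powr') auto
  then show ?thesis
    unfolding fan_def uw_def ew_def
    by (intro continuous_on_Pair continuous_on_add continuous_on_mult continuous_on_diff
        continuous_on_power continuous_on_divide continuous_on_const wave_continuous) auto
qed

section \<open>The conservation laws as ODEs in w\<close>

lemma uw_deriv: "(uw has_real_derivative - (q * s)) (at w)"
  unfolding uw_def[abs_def] by (auto intro!: derivative_eq_intros)

text \<open>Rewriting \<open>s * s\<close> as \<open>c * (q + 2)\<close> removes the quotient by q +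
  2, so that the ODEs below reduce to polynomial identities.\<close>

definition c :: real where "c = s\<^sup>2 / (q + 2)"

lemma s_times_s: "s * s = c * (q + 2)"
  using q_pos by (simp add: c_def power2_eq_square)

lemma s_times_s_left: "s * (s * x) = c * (q + 2) * x"
  by (simp only: mult.assoc[symmetric] s_times_s)

lemma pressure_coeff_c: "(\<gamma> - 1) * (E0 - 1/2) = q * c"
  by (simp add: pressure_coeff c_def)

lemma ew_c: "ew = (\<lambda>w. (uw w)\<^sup>2 / 2 + q\<^sup>2 * c / 2 * w\<^sup>2)"
  unfolding ew_def[abs_def] energy_coeff c_def by (simp add: mult.commute)

lemma ew_deriv: "(ew has_real_derivative q\<^sup>2 * c * w - q * s * uw w) (at w)"
  unfolding ew_c
  by (auto intro!: derivative_eq_intros uw_deriv)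

lemma powr_deriv: "0 < w \<Longrightarrow> ((\<lambda>w. w powr q) has_real_derivative q * (w powr q / w)) (at w)"
  by (auto intro!: derivative_eq_intros simp: powr_diff)

text \<open>The differentiated expression collapses to \<open>s * w * w powr q\<close>. The
  coefficient \<open>(q + 1) * s\<close> on the right is minus the slope of \<xi> as a function of
  w.\<close>

lemma mass_ode:
  assumes "0 < w"
  shows "((\<lambda>w. w powr q * uw w - (uw w - s * w) * w powr q) has_real_derivative
    (q + 1) * s * w powr q) (at w)"
proof -
  \<comment> \<open>With \<open>Y\<close> the power and its derivative become \<open>Y * w\<close>
    and \<open>q * Y\<close>, so only polynomial algebra in \<open>Y\<close> and w remains.\<close>
  define Y where "Y = w powr q / w"
  have Y: "w powr q = Y * w" using assms by (simp add: Y_def)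
  have d: "((\<lambda>w. w powr q) has_real_derivative q * Y) (at w)"
    unfolding Y_def by (rule powr_deriv[OF assms])
  show ?thesis
    by (rule DERIV_cong, (rule d uw_deriv DERIV_diff DERIV_mult DERIV_cmult DERIV_ident)+)
      (simp add: Y algebra_simps)
qed

text \<open>The expression collapses to
  \<open>q * c * w powr q * w\<^sup>2 + s * w * w powr q * uw w\<close>. The pressure derivative
  \<open>q * s\<^sup>2 * w * w powr q\<close> cancels against the term from u' = - q * s.\<close>

lemma momentum_ode:
  assumes "0 < w"
  shows "((\<lambda>w. w powr q * (uw w)\<^sup>2 + (\<gamma> - 1) * (E0 - 1/2) * w powr q * w\<^sup>2
      - (uw w - s * w) * (w powr q * uw w)) has_real_derivative
    (q + 1) * s * (w powr q * uw w)) (at w)"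
proof -
  define Y where "Y = w powr q / w"
  have Y: "w powr q = Y * w" using assms by (simp add: Y_def)
  have d: "((\<lambda>w. w powr q) has_real_derivative q * Y) (at w)"
    unfolding Y_def by (rule powr_deriv[OF assms])
  show ?thesis
    unfolding pressure_coeff_c power2_eq_square
    by (rule DERIV_cong, (rule d uw_deriv DERIV_add DERIV_diff DERIV_mult DERIV_const DERIV_ident)+)
      (simp add: Y algebra_simps s_times_s_left s_times_s)
qed

text \<open>The expression collapses to the pressure work
  \<open>q * c * uw w * w powr q * w\<^sup>2\<close> plus \<open>s * w * w powr q * ew w\<close>.
  The derivative of the work cancels against the term that contains the derivative of
  \<open>ew\<close>.\<close>

lemma energy_ode:
  assumes "0 < w"
  shows "((\<lambda>w. w powr q * uw w * ew w + uw w * ((\<gamma> - 1) * (E0 - 1/2) * w powr q * w\<^sup>2)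
      - (uw w - s * w) * (w powr q * ew w)) has_real_derivative
    (q + 1) * s * (w powr q * ew w)) (at w)"
proof -
  define Y where "Y = w powr q / w"
  have Y: "w powr q = Y * w" using assms by (simp add: Y_def)
  have d: "((\<lambda>w. w powr q) has_real_derivative q * Y) (at w)"
    unfolding Y_def by (rule powr_deriv[OF assms])
  have e: "ew w = uw w * uw w / 2 + q * q * c / 2 * (w * w)"
    by (simp add: ew_c power2_eq_square)
  show ?thesis
    unfolding pressure_coeff_c power2_eq_square
    by (rule DERIV_cong, (rule d uw_deriv ew_deriv DERIV_add DERIV_diff DERIV_mult DERIV_const DERIV_ident)+)
      (simp add: Y e algebra_simps s_times_s_left s_times_s power2_eq_square
        add_divide_distrib diff_divide_distrib)
qed

section \<open>Structure, uniqueness and admissibility of the fan\<close>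

lemma fan_rarefaction:
  assumes "\<xi>L < \<xi>" "\<xi> < \<xi>R"
  shows "rarefaction_state \<gamma> E0 \<xi> (fan \<xi>)"
proof -
  note w = wave_mid_bounds[OF assms]
  have q2: "q * ((\<gamma> - 1) / 2) = 1" using gamma_q(1) by (simp add: mult.commute)
  have q3: "q * \<gamma> = q + 2" using gamma_q(2) by (simp add: mult.commute)
  have "wave \<xi> powr (q + 2) = wave \<xi> powr q * (wave \<xi>)\<^sup>2"
    using w by (simp add: powr_add)
  moreover have "uw (wave \<xi>) = - 1 + 2 / ((\<gamma> - 1) * mach \<gamma> E0) * (1 - wave \<xi>)"
    by (simp add: uw_def q_def s_def)
  moreover have "\<xi> = uw (wave \<xi>) - (1 / mach \<gamma> E0) * wave \<xi>"
    using wave_characteristic[of \<xi>] assms by (simp add: s_def)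
  ultimately show ?thesis
    unfolding rarefaction_state_def Let_def fan_simps pres_fan powr_powr q2 q3
    using w by (simp add: mult.assoc)
qed

text \<open>As a function of w, u - s * w is affine with nonzero slope - (q + 1) * s, so \<xi> fixes
  w. Inverting the power gives the density, and the pressure law gives the energy after division by
  (\<gamma> - 1) * \<rho> > 0.\<close>

lemma rarefaction_unique:
  assumes r: "rarefaction_state \<gamma> E0 \<xi> S" and \<xi>: "\<xi>L < \<xi>" "\<xi> < \<xi>R"
  shows "S = fan \<xi>"
proof -
  obtain \<rho> u e where S: "S = (\<rho>, u, e)" by (metis prod.exhaust)
  define w where "w = \<rho> powr ((\<gamma> - 1) / 2)"
  have \<rho>: "\<rho> > 0" and u: "u = uw w" and p: "(\<gamma> - 1) * \<rho> * (e - u\<^sup>2 / 2) = (\<gamma> - 1) * (E0 - 1/2) * \<rho> powr \<gamma>"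
    and \<xi>w: "\<xi> = u - s * w"
    using r by (auto simp: rarefaction_state_def Let_def S dens_def vel_def energy_def pres_def w_def
        uw_def q_def s_def)
  have "uw w - s * w = uw (wave \<xi>) - s * wave \<xi>"
    using wave_characteristic[of \<xi>] \<xi> \<xi>w u by simp
  then have "(q + 1) * s * (w - wave \<xi>) = 0" by (simp add: uw_def algebra_simps)
  then have w: "w = wave \<xi>" using s_pos q_pos by auto
  have "(\<gamma> - 1) / 2 * q = 1" using gamma by (simp add: q_def)
  then have \<rho>w: "\<rho> = w powr q" using \<rho> by (simp only: w_def powr_powr) simp
  have "\<rho> powr \<gamma> = \<rho> powr (1 + (\<gamma> - 1) / 2 + (\<gamma> - 1) / 2)" by simp
  also have "\<dots> = \<rho> * w\<^sup>2"
    using \<rho> by (simp only: powr_add w_def) (simp add: power2_eq_square)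
  finally have "((\<gamma> - 1) * \<rho>) * (e - u\<^sup>2 / 2) = ((\<gamma> - 1) * \<rho>) * ((E0 - 1/2) * w\<^sup>2)"
    using p by (simp add: algebra_simps)
  then have "e = ew w" using \<rho> gamma u by (simp add: ew_def)
  then show ?thesis using S u w \<rho>w by (simp add: fan_def)
qed

text \<open>\<open>q * s\<close> is the velocity gained by complete expansion. Vacuum appears when
  this gain cannot stop gas that starts with velocity -1.\<close>

lemma mach_le_iff: "mach \<gamma> E0 \<le> 2 / (\<gamma> - 1) \<longleftrightarrow> q * s \<ge> 1"
  "mach \<gamma> E0 < 2 / (\<gamma> - 1) \<longleftrightarrow> q * s > 1"
  "mach \<gamma> E0 > 2 / (\<gamma> - 1) \<longleftrightarrow> q * s < 1"
proof -
  have m: "mach \<gamma> E0 = 1 / s" by (simp add: s_def)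
  show "mach \<gamma> E0 \<le> 2 / (\<gamma> - 1) \<longleftrightarrow> q * s \<ge> 1"
    "mach \<gamma> E0 < 2 / (\<gamma> - 1) \<longleftrightarrow> q * s > 1"
    "mach \<gamma> E0 > 2 / (\<gamma> - 1) \<longleftrightarrow> q * s < 1"
    unfolding m q_def[symmetric] using s_pos by (simp_all add: field_simps)
qed

lemma w1_pos: "q * s > 1 \<Longrightarrow> w1 = 1 - 1 / (q * s)" "q * s > 1 \<Longrightarrow> w1 > 0"
  using s_pos q_pos by (auto simp: w1_def)

lemma piston_structure_alt:
  "piston_structure \<gamma> E0 V \<longleftrightarrow>
     (\<forall>\<xi>. \<xi> \<le> \<xi>L \<longrightarrow> V \<xi> = (1, -1, E0))
   \<and> (\<forall>\<xi>. \<xi>L < \<xi> \<and> \<xi> < \<xi>R \<longrightarrow> rarefaction_state \<gamma> E0 \<xi> (V \<xi>))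
   \<and> (q * s > 1 \<longrightarrow> w1 powr q > 0 \<and> (\<exists>E1. \<forall>\<xi>. \<xi>R \<le> \<xi> \<and> \<xi> \<le> 0 \<longrightarrow> V \<xi> = (w1 powr q, 0, E1)))
   \<and> (q * s < 1 \<longrightarrow> (\<forall>\<xi>. \<xi>R \<le> \<xi> \<and> \<xi> \<le> 0 \<longrightarrow> dens (V \<xi>) = 0))"
proof -
  have R: "(if mach \<gamma> E0 \<le> 2 / (\<gamma> - 1) then (\<gamma> - 1) / 2 - 1 / mach \<gamma> E0
      else -1 + 2 / ((\<gamma> - 1) * mach \<gamma> E0)) = \<xi>R"
  proof -
    have "- 1 + 2 / ((\<gamma> - 1) * mach \<gamma> E0) = q * s - 1"
      "(\<gamma> - 1) / 2 - 1 / mach \<gamma> E0 = 1 / q - s"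
      by (simp_all add: q_def s_def)
    then show ?thesis
      unfolding mach_le_iff using \<xi>R_cases by (cases "1 \<le> q * s") simp_all
  qed
  have L: "-1 - 1 / mach \<gamma> E0 = \<xi>L" by (simp add: \<xi>L_def s_def)
  have w: "w1 = 1 - (\<gamma> - 1) * mach \<gamma> E0 / 2" if "q * s > 1"
  proof -
    have "1 / (q * s) = (\<gamma> - 1) * mach \<gamma> E0 / 2" by (simp add: q_def s_def)
    then show ?thesis using w1_pos(1)[OF that] by simp
  qed
  show ?thesis
    unfolding piston_structure_def Let_def R L unfolding mach_le_iff unfolding q_def[symmetric]
    using w by (cases "q * s > 1") simp_all
qed

lemma uw_w1: "q * s \<ge> 1 \<Longrightarrow> uw w1 = 0"
  using s_pos q_pos by (simp add: w1_def uw_def)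

lemma w1_zero: "q * s \<le> 1 \<Longrightarrow> w1 = 0"
  using s_pos q_pos by (simp add: w1_def field_simps)

lemma fan_structure: "piston_structure \<gamma> E0 fan"
  unfolding piston_structure_alt
  using fan_left fan_rarefaction w1_pos uw_w1 w1_zero
  by (auto simp: fan_def wave_right dens_def)

text \<open>The structure leaves the energy behind the wave free. Since \<open>lam1 = \<xi>R\<close> just left of \<open>\<xi>R\<close>, the Lax
  condition excludes a jump there, which determines that energy.\<close>
lemma fan_unique:
  assumes V: "piston_structure \<gamma> E0 V" "ss_lax_entropy \<gamma> V" and \<xi>: "\<xi> < 0"
  shows "V \<xi> = fan \<xi> \<or> dens (V \<xi>) = 0 \<and> dens (fan \<xi>) = 0"
proof -
  note st = V(1)[unfolded piston_structure_alt]
  have mid: "V \<eta> = fan \<eta>" if "\<xi>L < \<eta>" "\<eta> < \<xi>R" for \<eta>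
    using st that rarefaction_unique by blast
  consider "\<xi> \<le> \<xi>L" | "\<xi>L < \<xi>" "\<xi> < \<xi>R" | "\<xi>R \<le> \<xi>" "q * s < 1" | "\<xi>R \<le> \<xi>" "q * s = 1"
    | "\<xi>R \<le> \<xi>" "q * s > 1" by linarith
  then show ?thesis
  proof cases
    case 3
    \<comment> \<open>In the vacuum the structure fixes only the density, which is why the
      conclusion has a second alternative.\<close>
    then show ?thesis using st \<xi> w1_zero by (auto simp: fan_simps wave_right)
  next
    case 4
    \<comment> \<open>At the threshold the fan ends exactly at the piston, so no \<xi> < 0 is left
      in this case.\<close>
    then have "\<xi>R = 0" using q_pos by (simp add: \<xi>R_alt w1_zero)
    then show ?thesis using 4 \<xi> by simp
  next
    case 5
    then obtain E1 where E1: "\<And>\<eta>. \<xi>R \<le> \<eta> \<Longrightarrow> \<eta> \<le> 0 \<Longrightarrow> V \<eta> = (w1 powr q, 0, E1)"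
      using st by blast
    have neg: "\<xi>R < 0" using 5 \<xi> by simp
    let ?L = "fan \<xi>R" and ?R = "(w1 powr q, 0, E1) :: state"
    have L: "?L = (w1 powr q, 0, ew w1)" using 5 by (simp add: fan_def wave_right uw_w1)
    have pos: "w1 powr q > 0" using w1_pos 5 by simp
    have "(fan \<longlongrightarrow> ?L) (at_left \<xi>R)"
      using fan_continuous by (auto simp: continuous_on_def intro: tendsto_within_subset)
    moreover have "\<forall>\<^sub>F \<eta> in at_left \<xi>R. fan \<eta> = V \<eta>"
      using eventually_at_left_real[OF \<xi>L_less_\<xi>R] by eventually_elim (use mid in auto)
    ultimately have limL: "(V \<longlongrightarrow> ?L) (at_left \<xi>R)" by (rule Lim_transform_eventually)
    have "\<forall>\<^sub>F \<eta> in at_right \<xi>R. ?R = V \<eta>"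
      using eventually_at_right_real[OF neg] by eventually_elim (use E1 in auto)
    then have limR: "(V \<longlongrightarrow> ?R) (at_right \<xi>R)"
      using Lim_transform_eventually[OF tendsto_const] by blast
    have "?L = ?R"
    proof (rule ccontr)
      assume "?L \<noteq> ?R"
      then have lax: "lax_admissible \<gamma> \<xi>R ?L ?R"
        using V(2) neg limL limR pos unfolding ss_lax_entropy_def by (simp add: L dens_def)
      have "\<gamma> * pres \<gamma> ?L / dens ?L = s\<^sup>2 * w1\<^sup>2"
        using pos 5 unfolding pres_fan fan_simps s_square by (simp add: wave_right)
      then have "sound \<gamma> ?L = s * w1"
        using s_pos w1_bounds by (simp add: sound_def real_sqrt_mult)
      moreover have "s * w1 = - \<xi>R"
        using wave_characteristic[of \<xi>R] \<xi>L_less_\<xi>R 5 by (simp add: wave_right uw_w1)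
      \<comment> \<open>Since \<open>lam1\<close> of the left state equals \<open>\<xi>R\<close>,
        the strict inequalities of families 1 and 2 fail. Family 3 would need 0 =
        \<open>lam2\<close> < \<open>\<xi>R\<close>, against \<open>neg\<close>.\<close>
      ultimately show False
        using lax neg by (auto simp: lax_admissible_def lam1_def lam2_def L vel_def)
    qed
    then show ?thesis using 5 \<xi> E1 L by (simp add: fan_def wave_right uw_w1)
  qed (use st mid fan_left in auto)
qed

text \<open>The fan is continuous, so its one-sided limits agree and there is no jump to
  test.\<close>

lemma fan_lax: "ss_lax_entropy \<gamma> fan"
proof -
  have "L = R" if "(fan \<longlongrightarrow> L) (at_left \<xi>)" "(fan \<longlongrightarrow> R) (at_right \<xi>)" for \<xi> L R
  proof -
    have l: "(fan \<longlongrightarrow> fan \<xi>) (at \<xi> within A)" for A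
      using fan_continuous by (auto simp: continuous_on_def intro: tendsto_within_subset)
    show ?thesis
      using tendsto_unique[OF _ that(1) l] tendsto_unique[OF _ that(2) l] by simp
  qed
  then show ?thesis unfolding ss_lax_entropy_def by blast
qed

end

section \<open>The fan as an integral weak solution\<close>

lemma Linf_OmegaI:
  assumes "f \<in> borel_measurable borel" "\<And>z. \<bar>f z\<bar> \<le> B"
  shows "Linf_Omega f"
  unfolding Linf_Omega_def using assms(1) by (intro conjI exI[of _ B] AE_I2) (simp_all add: assms(2))

context piston
begin

text \<open>With \<open>x/t = uw w - s w\<close> in the fan, a conservation law \<open>\<partial>\<^sub>t f + \<partial>\<^sub>x g = 0\<close> becomes an ODE for
  \<open>g - (x/t) f\<close> as a function of \<open>w\<close>.\<close>
lemma wave_weak_identity: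
  assumes \<phi>: "test_fun \<phi>"
    and f: "continuous_on {0..1} f" and g: "continuous_on {0..1} g"
    and ode: "\<And>w. 0 < w \<Longrightarrow>
      ((\<lambda>w. g w - (uw w - s * w) * f w) has_real_derivative (q + 1) * s * f w) (at w)"
  shows "(LINT z:Omega|lborel. f (wave (snd z / fst z)) * Dt \<phi> z + g (wave (snd z / fst z)) * Dx \<phi> z)
    + f 1 * (LINT x:{..0}|lborel. \<phi> (0, x)) - g w1 * (LINT t:{0..}|lborel. \<phi> (t, 0)) = 0"
proof -
  have range: "wave \<xi> \<in> {0..1}" for \<xi> using wave_bounds[of \<xi>] wave_nonneg[of \<xi>] by simp
  have cf: "continuous_on UNIV (\<lambda>\<xi>. f (wave \<xi>))" and cg: "continuous_on UNIV (\<lambda>\<xi>. g (wave \<xi>))"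
    using continuous_on_compose2[OF f wave_continuous[of UNIV]]
      continuous_on_compose2[OF g wave_continuous[of UNIV]] range by blast+
  have "bounded (f ` {0..1} \<union> g ` {0..1})"
    using f g by (intro compact_imp_bounded compact_Un compact_continuous_image) auto
  then obtain C where C: "\<And>y. y \<in> f ` {0..1} \<union> g ` {0..1} \<Longrightarrow> \<bar>y\<bar> \<le> C"
    by (auto simp: bounded_iff)
  have w0: "wave 0 = w1" using wave_right \<xi>R_nonpos by simp
  have "(LINT z:Omega|lborel. f (wave (snd z / fst z)) * Dt \<phi> z + g (wave (snd z / fst z)) * Dx \<phi> z)
    + f 1 * (LINT x:{..0}|lborel. \<phi> (0, x)) - g (wave 0) * (LINT t:{0..}|lborel. \<phi> (t, 0)) = 0"
  \<comment> \<open>The head \<open>\<xi>L\<close> of the fan is the end point of the interval, so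
    the tail \<open>\<xi>R\<close> is the only kink that can lie inside.\<close>
  proof (rule self_similar_weak_identity[OF \<phi> \<xi>L_neg, where C = C and S = "{\<xi>R}" and ?G0.0 = "g 1"])
    show "\<bar>f (wave \<xi>)\<bar> \<le> C" "\<bar>g (wave \<xi>)\<bar> \<le> C" for \<xi>
      using range[of \<xi>] by (auto intro!: C)
    show "continuous_on {\<xi>L..0} (\<lambda>\<xi>. g (wave \<xi>) - \<xi> * f (wave \<xi>))"
      using cf cg by (intro continuous_intros) (auto intro: continuous_on_subset)
    show "((\<lambda>\<xi>. g (wave \<xi>) - \<xi> * f (wave \<xi>)) has_real_derivative - f (wave \<xi>)) (at \<xi>)"
      if \<xi>: "\<xi> \<in> {\<xi>L<..<0} - {\<xi>R}" for \<xi>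
    proof (cases "\<xi> < \<xi>R")
      case True
      have mid: "\<xi> \<in> {\<xi>L<..<\<xi>R}" using True \<xi> by simp
      define l where "l \<eta> = 1 - (1 + \<eta> + s) / ((q + 1) * s)" for \<eta>
      have l: "wave \<eta> = l \<eta>" if "\<eta> \<in> {\<xi>L<..<\<xi>R}" for \<eta>
        using wave_mid[of \<eta>] that by (simp add: l_def)
      have dl: "(l has_real_derivative - (1 / ((q + 1) * s))) (at \<xi>)"
        unfolding l_def[abs_def] divide_inverse[of _ "(q + 1) * s"]
        by (auto intro!: derivative_eq_intros)
      \<comment> \<open>On the open fan \<open>wave\<close> is the affine function \<open>l\<close>,
        whose slope turns the coefficient \<open>(q + 1) * s\<close> of the ODE into -1.\<close>
      have "((\<lambda>\<eta>. g (l \<eta>) - (uw (l \<eta>) - s * l \<eta>) * f (l \<eta>)) has_real_derivative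
          ((q + 1) * s * f (l \<xi>)) * - (1 / ((q + 1) * s))) (at \<xi>)"
        by (rule DERIV_chain2[OF ode dl]) (use wave_mid_bounds(3)[of \<xi>] mid l[OF mid] in auto)
      moreover have "((q + 1) * s * f (l \<xi>)) * - (1 / ((q + 1) * s)) = - f (wave \<xi>)"
        using denom_pos l[OF mid] by (simp add: field_simps)
      ultimately have "((\<lambda>\<eta>. g (l \<eta>) - (uw (l \<eta>) - s * l \<eta>) * f (l \<eta>)) has_real_derivative
          - f (wave \<xi>)) (at \<xi>)" by simp
      then show ?thesis
      proof (rule has_field_derivative_transform_within_open[where S = "{\<xi>L<..<\<xi>R}"])
        show "g (l \<eta>) - (uw (l \<eta>) - s * l \<eta>) * f (l \<eta>) = g (wave \<eta>) - \<eta> * f (wave \<eta>)"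
          if "\<eta> \<in> {\<xi>L<..<\<xi>R}" for \<eta>
          using wave_characteristic[of \<eta>] l[OF that] that by simp
      qed (use mid in auto)
    next
      case False
      have "((\<lambda>\<eta>. g w1 - \<eta> * f w1) has_real_derivative - f w1) (at \<xi>)"
        by (auto intro!: derivative_eq_intros)
      then have "((\<lambda>\<eta>. g (wave \<eta>) - \<eta> * f (wave \<eta>)) has_real_derivative - f w1) (at \<xi>)"
        by (rule has_field_derivative_transform_within_open[where S = "{\<xi>R<..}"])
          (use False \<xi> wave_right in auto)
      then show ?thesis using wave_right[of \<xi>] False by simp
    qed
  qed (use cf cg wave_left in \<open>auto intro: borel_measurable_continuous_onI\<close>)
  then show ?thesis by (simp add: w0)
qed

lemma fan_borel:
  "(\<lambda>z. dens (ss_field fan z)) \<in> borel_measurable borel"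
  "(\<lambda>z. vel (ss_field fan z)) \<in> borel_measurable borel"
  "(\<lambda>z. energy (ss_field fan z)) \<in> borel_measurable borel"
proof -
  have [measurable]: "fan \<in> borel_measurable borel"
    by (rule borel_measurable_continuous_onI[OF fan_continuous])
  have "(\<lambda>z. fan (snd z / fst z)) \<in> borel_measurable borel"
    unfolding borel_prod[symmetric, where ?'a = real and ?'b = real] by measurable
  then have m: "(\<lambda>z. ss_field fan z) \<in> borel_measurable borel"
    by (simp add: ss_field_def[abs_def])
  have c: "continuous_on UNIV dens" "continuous_on UNIV vel" "continuous_on UNIV energy"
    unfolding dens_def[abs_def] vel_def[abs_def] energy_def[abs_def] by (intro continuous_intros)+
  show "(\<lambda>z. dens (ss_field fan z)) \<in> borel_measurable borel"
    "(\<lambda>z. vel (ss_field fan z)) \<in> borel_measurable borel"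
    "(\<lambda>z. energy (ss_field fan z)) \<in> borel_measurable borel"
    using c[THEN borel_measurable_continuous_onI, THEN measurable_compose[OF m]] by auto
qed

lemma fan_bounds:
  "\<bar>dens (fan \<xi>)\<bar> \<le> 1" "\<bar>vel (fan \<xi>)\<bar> \<le> 1" "\<bar>energy (fan \<xi>)\<bar> \<le> E0"
  "\<bar>pres \<gamma> (fan \<xi>)\<bar> \<le> (\<gamma> - 1) * (E0 - 1/2)"
  using rho_bounds[of \<xi>] uw_bounds[OF wave_bounds, of \<xi>] ew_bounds[OF wave_bounds, of \<xi>]
    pres_fan_bounds[of \<xi>]
  by (auto simp: fan_simps)

text \<open>At the piston the gas is either at rest or absent. Therefore the mass and energy fluxes
  have no boundary term, and the momentum flux keeps only the pressure.\<close>

lemma piston_no_flux: "w1 powr q * uw w1 = 0"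
  using uw_w1 w1_zero by (cases "q * s \<ge> 1") auto

lemma fan_weak_solution: "ss_weak_solution_B \<gamma> E0 fan"
proof -
  have cw: "continuous_on {0..1} (\<lambda>w. w powr q)"
    using q_pos by (intro continuous_on_powr' continuous_intros) auto
  have cu: "continuous_on {0..1} uw" and ce: "continuous_on {0..1} ew"
    unfolding ew_def[abs_def] uw_def[abs_def] by (auto intro!: continuous_intros)
  note cont = continuous_on_mult continuous_on_add continuous_on_power continuous_on_const
    continuous_on_id cw cu ce
  have w0: "wave 0 = w1" using wave_right \<xi>R_nonpos by simp
  have mass: "(LINT z:Omega|lborel. dens (ss_field fan z) * Dt \<phi> z
      + dens (ss_field fan z) * vel (ss_field fan z) * Dx \<phi> z)
      + (LINT x:{..0}|lborel. 1 * \<phi> (0, x)) = 0" if \<phi>: "test_fun \<phi>" for \<phi>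
    using wave_weak_identity[OF \<phi>, of "\<lambda>w. w powr q" "\<lambda>w. w powr q * uw w"] mass_ode
    by (simp add: ss_field_def fan_simps cont piston_no_flux)
  have mom: "(LINT z:Omega|lborel. dens (ss_field fan z) * vel (ss_field fan z) * Dt \<phi> z
      + (dens (ss_field fan z) * (vel (ss_field fan z))\<^sup>2 + pres \<gamma> (ss_field fan z)) * Dx \<phi> z)
      - (LINT t:{0..}|lborel. pres \<gamma> (ss_field fan (t, 0)) * \<phi> (t, 0))
      + (LINT x:{..0}|lborel. 1 * -1 * \<phi> (0, x)) = 0" if \<phi>: "test_fun \<phi>" for \<phi>
  proof -
    have "w1 powr q * (uw w1)\<^sup>2 = (w1 powr q * uw w1) * uw w1" by (simp add: power2_eq_square)
    also have "\<dots> = 0" by (simp only: piston_no_flux mult_zero_left)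
    finally have G: "w1 powr q * (uw w1)\<^sup>2 + r = r" for r by (simp only: add_0)
    have "uw 1 = - 1" by (simp add: uw_def)
    moreover have "(LINT x:{..0}|lborel. - \<phi> (0, x)) = - (LINT x:{..0}|lborel. \<phi> (0, x))"
      by (simp add: set_lebesgue_integral_def)
    ultimately show ?thesis
      using wave_weak_identity[OF \<phi> _ _ momentum_ode, unfolded G]
      by (simp add: ss_field_def fan_simps pres_fan cont w0)
  qed
  have en: "(LINT z:Omega|lborel. dens (ss_field fan z) * energy (ss_field fan z) * Dt \<phi> z
      + (dens (ss_field fan z) * vel (ss_field fan z) * energy (ss_field fan z)
          + vel (ss_field fan z) * pres \<gamma> (ss_field fan z)) * Dx \<phi> z)
      + (LINT x:{..0}|lborel. 1 * E0 * \<phi> (0, x)) = 0" if \<phi>: "test_fun \<phi>" for \<phi>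
  proof -
    have "w1 powr q * uw w1 * ew w1 + uw w1 * ((\<gamma> - 1) * (E0 - 1/2) * w1 powr q * w1\<^sup>2) = 0"
      using piston_no_flux by auto
    moreover have "ew 1 = E0" by (simp add: ew_def uw_def)
    ultimately show ?thesis
      using wave_weak_identity[OF \<phi> _ _ energy_ode]
      by (simp add: ss_field_def fan_simps pres_fan cont w0)
  qed
  have "Linf_Omega (\<lambda>z. dens (ss_field fan z))" "Linf_Omega (\<lambda>z. vel (ss_field fan z))"
    "Linf_Omega (\<lambda>z. energy (ss_field fan z))"
    by (rule fan_borel[THEN Linf_OmegaI], simp only: ss_field_def, rule fan_bounds)+
  then show ?thesis
    unfolding ss_weak_solution_B_def euler_integral_identities_def
    using mass mom en fan_lax by blast
qed

lemma fan_solution: "piston_solution \<gamma> E0 fan"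
  using fan_weak_solution fan_structure by (simp add: piston_solution_def)

end

section \<open>The pressureless limit\<close>

lemma limit_profile_simps:
  "dens (limit_profile e \<xi>) = (if \<xi> \<le> -1 then 1 else 0)"
  "vel (limit_profile e \<xi>) = (if \<xi> \<le> -1 then -1 else 0)"
  "energy (limit_profile e \<xi>) = (if \<xi> \<le> -1 then e else 0)"
  by (simp_all add: limit_profile_def dens_def vel_def energy_def)

text \<open>Each limit law carries a quantity r with velocity -1, hence with flux - r. At the jump G
  - \<xi> * F = - r * (1 + \<xi>) vanishes, because the contact moves with the gas; beyond it
  everything is 0.\<close>

lemma step_weak_identity:
  fixes r :: real
  assumes \<phi>: "test_fun \<phi>"
  shows "(LINT z:Omega|lborel. (if snd z / fst z \<le> -1 then r else 0) * Dt \<phi> z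
      + (if snd z / fst z \<le> -1 then - r else 0) * Dx \<phi> z)
    + r * (LINT x:{..0}|lborel. \<phi> (0, x)) = 0"
proof -
  define F G where "F \<xi> = (if \<xi> \<le> -1 then r else 0)" and "G \<xi> = (if \<xi> \<le> -1 then - r else 0)"
    for \<xi> :: real
  have "(LINT z:Omega|lborel. F (snd z / fst z) * Dt \<phi> z + G (snd z / fst z) * Dx \<phi> z)
    + r * (LINT x:{..0}|lborel. \<phi> (0, x)) - G 0 * (LINT t:{0..}|lborel. \<phi> (t, 0)) = 0"
  proof (rule self_similar_weak_identity[OF \<phi>, where a = "-1" and C = "\<bar>r\<bar>" and S = "{}" and ?G0.0 = "- r"])
    show "F \<in> borel_measurable borel" "G \<in> borel_measurable borel"
      unfolding F_def G_def by measurable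
    have z: "G \<xi> - \<xi> * F \<xi> = 0" if "\<xi> \<ge> -1" for \<xi>
      using that by (auto simp: F_def G_def)
    then show "continuous_on {-1..0} (\<lambda>\<xi>. G \<xi> - \<xi> * F \<xi>)"
      by (subst continuous_on_cong[OF refl, where g = "\<lambda>_. 0"]) auto
    show "((\<lambda>\<xi>. G \<xi> - \<xi> * F \<xi>) has_real_derivative - F \<xi>) (at \<xi>)" if "\<xi> \<in> {-1<..<0} - {}" for \<xi>
    proof -
      have "((\<lambda>\<xi>. 0) has_real_derivative 0) (at \<xi>)" by simp
      then have "((\<lambda>\<xi>. G \<xi> - \<xi> * F \<xi>) has_real_derivative 0) (at \<xi>)"
        by (rule has_field_derivative_transform_within_open[where S = "{-1<..}"])
          (use that z in auto)
      then show ?thesis using that by (simp add: F_def)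
    qed
  qed (auto simp: F_def G_def)
  then show ?thesis by (simp add: F_def G_def)
qed

lemma limit_profile_borel:
  "(\<lambda>z. dens (ss_field (limit_profile e) z)) \<in> borel_measurable borel"
  "(\<lambda>z. vel (ss_field (limit_profile e) z)) \<in> borel_measurable borel"
  "(\<lambda>z. energy (ss_field (limit_profile e) z)) \<in> borel_measurable borel"
  unfolding ss_field_def limit_profile_simps borel_prod[symmetric, where ?'a = real and ?'b = real]
  by measurable

lemma limit_profile_weak_solution:
  "pressureless_weak_solution (ss_field (limit_profile e)) (\<lambda>_. 1) (\<lambda>_. -1) (\<lambda>_. e)"
proof -
  have Linf: "Linf_Omega (\<lambda>z. dens (ss_field (limit_profile e) z))"
    "Linf_Omega (\<lambda>z. vel (ss_field (limit_profile e) z))"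
    "Linf_Omega (\<lambda>z. energy (ss_field (limit_profile e) z))"
    by (rule limit_profile_borel[THEN Linf_OmegaI[where B = "max 1 \<bar>e\<bar>"]],
        simp add: ss_field_def limit_profile_simps le_max_iff_disj)+
  have if_simps: "(if P then (1::real) else 0) * (if P then -1 else 0) = (if P then -1 else 0)"
    "(if P then (-1::real) else 0)\<^sup>2 = (if P then 1 else 0)"
    "(if P then (1::real) else 0) * (if P then 1 else 0) = (if P then 1 else 0)"
    "(if P then (1::real) else 0) * (if P then e else 0) = (if P then e else 0)"
    "(if P then (-1::real) else 0) * (if P then e else 0) = (if P then - e else 0)" for P
    by auto
  have neg: "(LINT x:{..0}|lborel. - \<phi> (0, x)) = - (LINT x:{..0}|lborel. \<phi> (0, x))"
    for \<phi> :: "real \<times> real \<Rightarrow> real"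
    by (simp add: set_lebesgue_integral_def)
  show ?thesis
    using Linf
    unfolding pressureless_weak_solution_def ss_field_def limit_profile_simps if_simps
    using step_weak_identity[of _ 1] step_weak_identity[of _ "-1", unfolded minus_minus]
      step_weak_identity[of _ e]
    by (simp add: neg)
qed

text \<open>The ray x = - t carries the limiting contact discontinuity, and pointwise convergence is
  claimed only off it.\<close>

lemma AE_off_antidiagonal: "AE z in lborel. snd z \<noteq> - fst (z :: real \<times> real)"
proof -
  have "negligible {z :: real \<times> real. (1, 1) \<bullet> z = 0}"
    by (rule negligible_hyperplane) (simp add: zero_prod_def)
  moreover have "{z :: real \<times> real. (1, 1) \<bullet> z = 0} = {z. snd z = - fst z}"
    by (auto simp: inner_prod_def)
  ultimately have "{z :: real \<times> real. snd z = - fst z} \<in> null_sets lebesgue"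
    by (simp add: negligible_iff_null_sets)
  moreover have "closed {z :: real \<times> real. snd z = - fst z}"
    by (intro closed_Collect_eq continuous_intros)
  then have "{z :: real \<times> real. snd z = - fst z} \<in> sets lborel" by simp
  ultimately have "{z :: real \<times> real. snd z = - fst z} \<in> null_sets lborel"
    by (simp add: null_sets_completion_iff)
  then show ?thesis by (rule AE_I') auto
qed

section \<open>Passage to the limit in the measures\<close>

lemma LINT_Omega_dominated:
  fixes Q :: "nat \<Rightarrow> real \<times> real \<Rightarrow> real"
  assumes \<phi>: "cc_fun \<phi>"
    and [measurable]: "\<And>n. Q n \<in> borel_measurable borel" "P \<in> borel_measurable borel"
    and bd: "\<And>n z. z \<in> Omega \<Longrightarrow> \<bar>Q n z\<bar> \<le> B"
    and lim: "\<And>z. z \<in> Omega \<Longrightarrow> snd z \<noteq> - fst z \<Longrightarrow> (\<lambda>n. Q n z) \<longlonglongrightarrow> P z"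
  shows "(\<lambda>n. LINT z:Omega|lborel. Q n z * \<phi> z) \<longlonglongrightarrow> (LINT z:Omega|lborel. P z * \<phi> z)"
proof -
  obtain R where R: "R > 0" "\<And>z. \<phi> z \<noteq> 0 \<Longrightarrow> norm z \<le> R"
    using \<phi> unfolding cc_fun_def bounded_pos by auto
  have out: "\<phi> z = 0" if "norm z > R" for z using R(2)[of z] that by linarith
  have cont: "continuous_on UNIV \<phi>" using \<phi> by (simp add: cc_fun_def)
  then have [measurable]: "\<phi> \<in> borel_measurable borel" by (rule borel_measurable_continuous_onI)
  obtain C where C: "C > 0" "\<And>z. \<bar>\<phi> z\<bar> \<le> C"
    using continuous_bounded_support[OF cont out] by blast
  show ?thesis
    unfolding set_lebesgue_integral_def
  proof (rule integral_dominated_convergence[where w = "\<lambda>z. \<bar>B\<bar> * \<bar>\<phi> z\<bar>"])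
    show "integrable lborel (\<lambda>z. \<bar>B\<bar> * \<bar>\<phi> z\<bar>)"
      by (rule integrable_bounded_support[where B = "\<bar>B\<bar> * C" and R = R])
        (use C out in \<open>auto simp: abs_mult intro!: mult_left_mono\<close>)
    show "AE z in lborel. (\<lambda>n. indicator Omega z *\<^sub>R (Q n z * \<phi> z))
        \<longlonglongrightarrow> indicator Omega z *\<^sub>R (P z * \<phi> z)"
      using AE_off_antidiagonal
    proof eventually_elim
      case (elim z)
      then show ?case
        by (cases "z \<in> Omega") (auto intro!: tendsto_intros lim)
    qed
    show "AE z in lborel. norm (indicator Omega z *\<^sub>R (Q n z * \<phi> z)) \<le> \<bar>B\<bar> * \<bar>\<phi> z\<bar>" for n
    proof (rule AE_I2)
      show "norm (indicator Omega z *\<^sub>R (Q n z * \<phi> z)) \<le> \<bar>B\<bar> * \<bar>\<phi> z\<bar>" for z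
        using bd[of z n] by (cases "z \<in> Omega") (auto simp: abs_mult intro!: mult_right_mono)
    qed
  qed measurable
qed

lemma borel_if_le:
  "(\<lambda>z :: real \<times> real. if snd z / fst z \<le> -1 then r else (0::real)) \<in> borel_measurable borel"
  unfolding borel_prod[symmetric] by measurable

text \<open>One statement for all seven measures, with \<open>Q\<close> the integrand. Vanishing of
  \<open>Q\<close> at zero density lets the fan replace \<open>V\<close>. In \<open>Q_bd\<close> the
  first term serves the quantities with a factor \<rho>, the second, the initial pressure, those
  with a factor p; both tend to 0 for -1 < \<xi> < 0.\<close>

lemma fan_limit_sequence:
  fixes g e :: "nat \<Rightarrow> real" and V :: "nat \<Rightarrow> real \<Rightarrow> state"
  assumes ps: "\<And>n. piston (g n) (e n)"
    and V: "\<And>n \<xi>. \<xi> < 0 \<Longrightarrow> V n \<xi> = piston.fan (g n) (e n) \<xi> \<or>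
          dens (V n \<xi>) = 0 \<and> dens (piston.fan (g n) (e n) \<xi>) = 0"
    and e: "e \<longlonglongrightarrow> einf" and s: "(\<lambda>n. piston.s (g n) (e n)) \<longlonglongrightarrow> 0"
    and p: "(\<lambda>n. (g n - 1) * (e n - 1/2)) \<longlonglongrightarrow> 0"
    and rho: "\<And>\<xi>. - 1 < \<xi> \<Longrightarrow> \<xi> < 0 \<Longrightarrow> (\<lambda>n. dens (piston.fan (g n) (e n) \<xi>)) \<longlonglongrightarrow> 0"
    and \<phi>: "cc_fun \<phi>"
    and Q0: "\<And>\<gamma> S. dens S = 0 \<Longrightarrow> Q \<gamma> S = 0"
    and Q_meas: "\<And>n. (\<lambda>z. Q (g n) (ss_field (piston.fan (g n) (e n)) z)) \<in> borel_measurable borel"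
    and Q_bd: "\<And>n \<xi>. \<bar>Q (g n) (piston.fan (g n) (e n) \<xi>)\<bar>
        \<le> C * dens (piston.fan (g n) (e n) \<xi>) + (g n - 1) * (e n - 1/2)"
    and Q_lim: "(\<lambda>n. Q (g n) (1, -1, e n)) \<longlonglongrightarrow> r"
  shows "(\<lambda>n. LINT z:Omega|lborel. Q (g n) (ss_field (V n) z) * \<phi> z)
    \<longlonglongrightarrow> (LINT z:Omega|lborel. (if snd z / fst z \<le> -1 then r else 0) * \<phi> z)"
proof -
  let ?F = "\<lambda>n. piston.fan (g n) (e n)"
  obtain B where B: "\<And>n. \<bar>(g n - 1) * (e n - 1/2)\<bar> \<le> B"
    using BseqE[OF convergent_imp_Bseq[OF convergentI[OF p]]] unfolding real_norm_def by blast
  have neg: "snd z / fst z < 0" if "z \<in> Omega" for z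
    using that by (auto simp: Omega_def divide_less_0_iff)
  have "Q (g n) (ss_field (V n) z) = Q (g n) (ss_field (?F n) z)" if "z \<in> Omega" for n z
    using V[OF neg[OF that], of n] Q0[of "V n (snd z / fst z)" "g n"]
      Q0[of "piston.fan (g n) (e n) (snd z / fst z)" "g n"]
    unfolding ss_field_def by metis
  then have eq: "(LINT z:Omega|lborel. Q (g n) (ss_field (V n) z) * \<phi> z)
      = (LINT z:Omega|lborel. Q (g n) (ss_field (?F n) z) * \<phi> z)" for n
    by (intro set_lebesgue_integral_cong) auto
  show ?thesis
    unfolding eq
  proof (rule LINT_Omega_dominated[OF \<phi> Q_meas borel_if_le, where B = "\<bar>C\<bar> + B"])
    show "\<bar>Q (g n) (ss_field (?F n) z)\<bar> \<le> \<bar>C\<bar> + B" for n z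
    proof -
      have "\<bar>C * dens (?F n (snd z / fst z))\<bar> \<le> \<bar>C\<bar> * 1"
        unfolding abs_mult using piston.fan_bounds(1)[OF ps] by (intro mult_left_mono) auto
      then show ?thesis
        using Q_bd[of n "snd z / fst z"] B[of n] unfolding ss_field_def by linarith
    qed
    fix z :: "real \<times> real" assume z: "z \<in> Omega" "snd z \<noteq> - fst z"
    let ?\<xi> = "snd z / fst z"
    have "?\<xi> \<noteq> -1" using z by (auto simp: Omega_def field_simps)
    then consider "?\<xi> < -1" | "-1 < ?\<xi>" by linarith
    then show "(\<lambda>n. Q (g n) (ss_field (?F n) z)) \<longlonglongrightarrow> (if ?\<xi> \<le> -1 then r else 0)"
    proof cases
      case 1
      \<comment> \<open>Once s < - 1 - \<xi>, the ray lies to the left of the head of the fan, in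
        the initial state.\<close>
      have "\<forall>\<^sub>F n in sequentially. piston.s (g n) (e n) < - 1 - ?\<xi>"
        using 1 by (intro order_tendstoD(2)[OF s]) simp
      then have "\<forall>\<^sub>F n in sequentially. Q (g n) (1, -1, e n) = Q (g n) (ss_field (?F n) z)"
      proof eventually_elim
        case (elim n)
        then have "?\<xi> \<le> piston.\<xi>L (g n) (e n)" unfolding piston.\<xi>L_def[OF ps] by simp
        then show ?case using piston.fan_left[OF ps] by (simp add: ss_field_def)
      qed
      then have "(\<lambda>n. Q (g n) (ss_field (?F n) z)) \<longlonglongrightarrow> r"
        by (rule Lim_transform_eventually[OF Q_lim])
      then show ?thesis using 1 by simp
    next
      case 2
      have "(\<lambda>n. C * dens (?F n ?\<xi>) + (g n - 1) * (e n - 1/2)) \<longlonglongrightarrow> C * 0 + 0"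
        by (intro tendsto_intros rho p 2 neg z)
      then have "(\<lambda>n. C * dens (?F n ?\<xi>) + (g n - 1) * (e n - 1/2)) \<longlonglongrightarrow> 0"
        by (simp only: mult_zero_right add_0)
      then have "(\<lambda>n. Q (g n) (?F n ?\<xi>)) \<longlonglongrightarrow> 0"
        by (rule Lim_null_comparison[rotated]) (simp only: real_norm_def Q_bd eventually_True)
      then show ?thesis using 2 by (simp add: ss_field_def)
    qed
  qed
qed

text \<open>The parameter k stands for E0 in the first case and for \<gamma> in the second. The
  one-sided limit is tested along sequences, as dominated convergence requires.\<close>

lemma measures_converge_fan:
  fixes g e :: "real \<Rightarrow> real" and V :: "real \<Rightarrow> real \<Rightarrow> state"
  assumes ps: "\<And>k. k > a \<Longrightarrow> piston (g k) (e k)"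
    and V: "\<And>k. k > a \<Longrightarrow> piston_solution (g k) (e k) (V k)"
    and e: "(e \<longlongrightarrow> einf) (at_right a)" and s: "((\<lambda>k. piston.s (g k) (e k)) \<longlongrightarrow> 0) (at_right a)"
    and p: "((\<lambda>k. (g k - 1) * (e k - 1/2)) \<longlongrightarrow> 0) (at_right a)"
    and rho: "\<And>\<xi>. - 1 < \<xi> \<Longrightarrow> \<xi> < 0 \<Longrightarrow> ((\<lambda>k. dens (piston.fan (g k) (e k) \<xi>)) \<longlongrightarrow> 0) (at_right a)"
  shows "measures_converge g V (at_right a) (limit_profile einf)"
proof -
  have lim: "((\<lambda>k. LINT z:Omega|lborel. Q (g k) (ss_field (V k) z) * \<phi> z)
      \<longlongrightarrow> (LINT z:Omega|lborel. (if snd z / fst z \<le> -1 then r else 0) * \<phi> z)) (at_right a)"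
    if \<phi>: "cc_fun \<phi>" and Q0: "\<And>\<gamma> S. dens S = 0 \<Longrightarrow> Q \<gamma> S = 0"
    and Q_meas: "\<And>k. k > a \<Longrightarrow> (\<lambda>z. Q (g k) (ss_field (piston.fan (g k) (e k)) z)) \<in> borel_measurable borel"
    and Q_bd: "\<And>k \<xi>. k > a \<Longrightarrow> \<bar>Q (g k) (piston.fan (g k) (e k) \<xi>)\<bar>
        \<le> (1 + e k) * dens (piston.fan (g k) (e k) \<xi>) + (g k - 1) * (e k - 1/2)"
    and Q_lim: "((\<lambda>k. Q (g k) (1, -1, e k)) \<longlongrightarrow> r) (at_right a)"
    for \<phi> Q r
  proof (rule tendsto_at_right_sequentially[of a "a + 1"])
    fix S :: "nat \<Rightarrow> real" assume S: "\<And>n. a < S n" "S \<longlonglongrightarrow> a"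
    have f: "filterlim S (at_right a) sequentially"
      using S less_imp_neq[OF S(1), symmetric] by (simp add: filterlim_at)
    note c = filterlim_compose[OF _ f]
    \<comment> \<open>The bound \<open>Q_bd\<close> depends on k through \<open>e k\<close>; a bound
      on the convergent energies makes it uniform along the sequence.\<close>
    obtain C where C: "\<And>n. \<bar>e (S n)\<bar> \<le> C"
      using BseqE[OF convergent_imp_Bseq[OF convergentI[OF c[OF e]]]] unfolding real_norm_def by blast
    show "(\<lambda>n. LINT z:Omega|lborel. Q (g (S n)) (ss_field (V (S n)) z) * \<phi> z)
      \<longlonglongrightarrow> (LINT z:Omega|lborel. (if snd z / fst z \<le> -1 then r else 0) * \<phi> z)"
    proof (rule fan_limit_sequence[where e = "\<lambda>n. e (S n)" and g = "\<lambda>n. g (S n)" and C = "1 + C", OF ps[OF S(1)] _ c[OF e] c[OF s] c[OF p] c[OF rho] \<phi> Q0 Q_meas[OF S(1)] _ c[OF Q_lim]])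
      show "V (S n) \<xi> = piston.fan (g (S n)) (e (S n)) \<xi> \<or>
          dens (V (S n) \<xi>) = 0 \<and> dens (piston.fan (g (S n)) (e (S n)) \<xi>) = 0" if "\<xi> < 0" for n \<xi>
        using piston.fan_unique[OF ps[OF S(1)]] V[OF S(1)] that
        unfolding piston_solution_def ss_weak_solution_B_def by blast
      show "\<bar>Q (g (S n)) (piston.fan (g (S n)) (e (S n)) \<xi>)\<bar>
        \<le> (1 + C) * dens (piston.fan (g (S n)) (e (S n)) \<xi>) + (g (S n) - 1) * (e (S n) - 1/2)" for n \<xi>
      proof -
        have "(1 + e (S n)) * dens (piston.fan (g (S n)) (e (S n)) \<xi>)
            \<le> (1 + C) * dens (piston.fan (g (S n)) (e (S n)) \<xi>)"
          using C[of n] piston.rho_bounds(1)[OF ps[OF S(1)]]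
          by (intro mult_right_mono) (auto simp: piston.fan_simps[OF ps[OF S(1)]])
        then show ?thesis using Q_bd[OF S(1), of n \<xi>] by linarith
      qed
    qed
  qed simp
  have pos: "0 \<le> (g k - 1) * (e k - 1/2)" if "k > a" for k
    using ps[OF that] by (simp add: piston_def)
  have ek: "e k > 0" if "k > a" for k using ps[OF that] by (simp add: piston_def)
  have d: "0 \<le> dens (piston.fan (g k) (e k) \<xi>)" if "k > a" for k \<xi>
    using piston.rho_bounds(1)[OF ps[OF that]] by (simp add: piston.fan_simps[OF ps[OF that]])
  \<comment> \<open>\<open>1 + e k\<close> dominates every factor that multiplies the density: 1 for
    powers of the velocity, \<open>e k\<close> for the energy.\<close>
  have dom: "\<bar>dens (piston.fan (g k) (e k) \<xi>) * y\<bar>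
      \<le> (1 + e k) * dens (piston.fan (g k) (e k) \<xi>) + (g k - 1) * (e k - 1/2)"
    if "k > a" "\<bar>y\<bar> \<le> 1 + e k" for k \<xi> y
  proof -
    have "\<bar>dens (piston.fan (g k) (e k) \<xi>) * y\<bar> \<le> dens (piston.fan (g k) (e k) \<xi>) * (1 + e k)"
      using d[OF that(1)] that(2) by (simp add: abs_mult mult_left_mono)
    then show ?thesis using pos[OF that(1)] by (simp add: mult.commute)
  qed
  note b = piston.fan_bounds[OF ps]
  note m = piston.fan_borel[OF ps]
  have m_pres: "(\<lambda>z. pres (g k) (ss_field (piston.fan (g k) (e k)) z)) \<in> borel_measurable borel"
    if "k > a" for k
    unfolding pres_def using m[OF that] by measurable
  have v2: "(vel (piston.fan (g k) (e k) \<xi>))\<^sup>2 \<le> 1" if "k > a" for k \<xi>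
    using b(2)[OF that] by (simp add: abs_square_le_1)
  have ve: "\<bar>vel (piston.fan (g k) (e k) \<xi>) * energy (piston.fan (g k) (e k) \<xi>)\<bar> \<le> 1 * e k" if "k > a" for k \<xi>
    unfolding abs_mult using b(2,3)[OF that, of \<xi>] by (intro mult_mono) auto
  have vp: "\<bar>vel (piston.fan (g k) (e k) \<xi>) * pres (g k) (piston.fan (g k) (e k) \<xi>)\<bar>
      \<le> 1 * ((g k - 1) * (e k - 1/2))" if "k > a" for k \<xi>
    unfolding abs_mult using b(2,4)[OF that, of \<xi>] by (intro mult_mono) auto
  have small: "y \<le> (1 + e k) * dens (piston.fan (g k) (e k) \<xi>) + (g k - 1) * (e k - 1/2)"
    if "k > a" "y \<le> (g k - 1) * (e k - 1/2)" for k \<xi> y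
    using that d[OF that(1), of \<xi>] ek[OF that(1)] by (simp add: add_increasing)
  have p1: "((\<lambda>k. pres (g k) (1, - 1, e k)) \<longlongrightarrow> 0) (at_right a)"
    using p by (simp add: pres_def dens_def vel_def energy_def)
  have c: "dens (1, -1, e k) = 1" "vel (1, -1, e k) = -1" "energy (1, -1, e k) = e k" for k
    by (simp_all add: dens_def vel_def energy_def)
  have l: "dens (ss_field (limit_profile einf) z) = (if snd z / fst z \<le> -1 then 1 else 0)"
    "dens (ss_field (limit_profile einf) z) * vel (ss_field (limit_profile einf) z)
      = (if snd z / fst z \<le> -1 then -1 else 0)"
    "dens (ss_field (limit_profile einf) z) * (vel (ss_field (limit_profile einf) z))\<^sup>2
      = (if snd z / fst z \<le> -1 then 1 else 0)"
    "dens (ss_field (limit_profile einf) z) * energy (ss_field (limit_profile einf) z)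
      = (if snd z / fst z \<le> -1 then einf else 0)"
    "dens (ss_field (limit_profile einf) z) * vel (ss_field (limit_profile einf) z)
      * energy (ss_field (limit_profile einf) z) = (if snd z / fst z \<le> -1 then - einf else 0)" for z
    by (auto simp: ss_field_def limit_profile_simps)
  show ?thesis
    \<comment> \<open>The longest product is rewritten first, since the left-hand sides of
      \<open>l(2)\<close> and \<open>l(1)\<close> occur inside it.\<close>
    unfolding measures_converge_def unfolding l(5) unfolding l(2-4) unfolding l(1)
  proof (intro allI impI conjI)
    fix \<phi> assume \<phi>: "cc_fun \<phi>"
    show "((\<lambda>k. LINT z:Omega|lborel. dens (ss_field (V k) z) * \<phi> z)
      \<longlongrightarrow> (LINT z:Omega|lborel. (if snd z / fst z \<le> -1 then 1 else 0) * \<phi> z)) (at_right a)"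
    proof (rule lim[OF \<phi>, where Q = "\<lambda>_. dens"])
      show "\<bar>dens (piston.fan (g k) (e k) \<xi>)\<bar>
        \<le> (1 + e k) * dens (piston.fan (g k) (e k) \<xi>) + (g k - 1) * (e k - 1/2)" if "k > a" for k \<xi>
        using dom[OF that, of 1 \<xi>] ek[OF that] by simp
    qed (use m in \<open>auto simp: c\<close>)
    show "((\<lambda>k. LINT z:Omega|lborel. dens (ss_field (V k) z) * vel (ss_field (V k) z) * \<phi> z)
      \<longlongrightarrow> (LINT z:Omega|lborel. (if snd z / fst z \<le> -1 then -1 else 0) * \<phi> z)) (at_right a)"
    proof (rule lim[OF \<phi>, where Q = "\<lambda>_ S. dens S * vel S"])
      show "\<bar>dens (piston.fan (g k) (e k) \<xi>) * vel (piston.fan (g k) (e k) \<xi>)\<bar>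
        \<le> (1 + e k) * dens (piston.fan (g k) (e k) \<xi>) + (g k - 1) * (e k - 1/2)" if "k > a" for k \<xi>
        by (rule dom[OF that]) (use b(2)[OF that, of \<xi>] ek[OF that] in auto)
    qed (use m in \<open>auto simp: c\<close>)
    show "((\<lambda>k. LINT z:Omega|lborel. dens (ss_field (V k) z) * (vel (ss_field (V k) z))\<^sup>2 * \<phi> z)
      \<longlongrightarrow> (LINT z:Omega|lborel. (if snd z / fst z \<le> -1 then 1 else 0) * \<phi> z)) (at_right a)"
    proof (rule lim[OF \<phi>, where Q = "\<lambda>_ S. dens S * (vel S)\<^sup>2"])
      show "\<bar>dens (piston.fan (g k) (e k) \<xi>) * (vel (piston.fan (g k) (e k) \<xi>))\<^sup>2\<bar>
        \<le> (1 + e k) * dens (piston.fan (g k) (e k) \<xi>) + (g k - 1) * (e k - 1/2)" if "k > a" for k \<xi>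
        by (rule dom[OF that]) (use v2[OF that, of \<xi>] ek[OF that] in auto)
    qed (use m in \<open>auto simp: c\<close>)
    show "((\<lambda>k. LINT z:Omega|lborel. dens (ss_field (V k) z) * energy (ss_field (V k) z) * \<phi> z)
      \<longlongrightarrow> (LINT z:Omega|lborel. (if snd z / fst z \<le> -1 then einf else 0) * \<phi> z)) (at_right a)"
    proof (rule lim[OF \<phi>, where Q = "\<lambda>_ S. dens S * energy S"])
      show "\<bar>dens (piston.fan (g k) (e k) \<xi>) * energy (piston.fan (g k) (e k) \<xi>)\<bar>
        \<le> (1 + e k) * dens (piston.fan (g k) (e k) \<xi>) + (g k - 1) * (e k - 1/2)" if "k > a" for k \<xi>
        by (rule dom[OF that]) (use b(3)[OF that, of \<xi>] in auto)
    qed (use m e in \<open>auto simp: c\<close>)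
    show "((\<lambda>k. LINT z:Omega|lborel. dens (ss_field (V k) z) * vel (ss_field (V k) z) * energy (ss_field (V k) z) * \<phi> z)
      \<longlongrightarrow> (LINT z:Omega|lborel. (if snd z / fst z \<le> -1 then - einf else 0) * \<phi> z)) (at_right a)"
    proof (rule lim[OF \<phi>, where Q = "\<lambda>_ S. dens S * vel S * energy S"])
      show "\<bar>dens (piston.fan (g k) (e k) \<xi>) * vel (piston.fan (g k) (e k) \<xi>) * energy (piston.fan (g k) (e k) \<xi>)\<bar>
        \<le> (1 + e k) * dens (piston.fan (g k) (e k) \<xi>) + (g k - 1) * (e k - 1/2)" if "k > a" for k \<xi>
        unfolding mult.assoc[of "dens _" "vel _"] by (rule dom[OF that]) (use ve[OF that, of \<xi>] in auto)
      show "((\<lambda>k. dens (1, - 1, e k) * vel (1, - 1, e k) * energy (1, - 1, e k)) \<longlongrightarrow> - einf) (at_right a)"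
        using tendsto_minus[OF e] by (simp add: c)
    qed (use m in auto)
    \<comment> \<open>The limit 0 is written as a step with r = 0 so that \<open>lim\<close>
      applies.\<close>
    have "((\<lambda>k. LINT z:Omega|lborel. vel (ss_field (V k) z) * pres (g k) (ss_field (V k) z) * \<phi> z)
      \<longlongrightarrow> (LINT z:Omega|lborel. (if snd z / fst z \<le> -1 then 0 else 0) * \<phi> z)) (at_right a)"
    proof (rule lim[OF \<phi>, where Q = "\<lambda>\<gamma> S. vel S * pres \<gamma> S"])
      show "\<bar>vel (piston.fan (g k) (e k) \<xi>) * pres (g k) (piston.fan (g k) (e k) \<xi>)\<bar>
        \<le> (1 + e k) * dens (piston.fan (g k) (e k) \<xi>) + (g k - 1) * (e k - 1/2)" if "k > a" for k \<xi>
        by (rule small[OF that]) (use vp[OF that, of \<xi>] in auto)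
      show "((\<lambda>k. vel (1, - 1, e k) * pres (g k) (1, - 1, e k)) \<longlongrightarrow> 0) (at_right a)"
        using tendsto_minus[OF p1] by (simp add: c)
    qed (use m m_pres in \<open>auto simp: pres_def\<close>)
    then show "((\<lambda>k. LINT z:Omega|lborel. vel (ss_field (V k) z) * pres (g k) (ss_field (V k) z) * \<phi> z)
      \<longlongrightarrow> 0) (at_right a)" by simp
    have "((\<lambda>k. LINT z:Omega|lborel. pres (g k) (ss_field (V k) z) * \<phi> z)
      \<longlongrightarrow> (LINT z:Omega|lborel. (if snd z / fst z \<le> -1 then 0 else 0) * \<phi> z)) (at_right a)"
    proof (rule lim[OF \<phi>, where Q = pres])
      show "\<bar>pres (g k) (piston.fan (g k) (e k) \<xi>)\<bar>
        \<le> (1 + e k) * dens (piston.fan (g k) (e k) \<xi>) + (g k - 1) * (e k - 1/2)" if "k > a" for k \<xi>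
        by (rule small[OF that]) (use b(4)[OF that, of \<xi>] in auto)
    qed (use m_pres p1 in \<open>auto simp: pres_def\<close>)
    then show "((\<lambda>k. LINT z:Omega|lborel. pres (g k) (ss_field (V k) z) * \<phi> z)
      \<longlongrightarrow> 0) (at_right a)" by simp
  qed
qed

section \<open>The two limits of the Mach number\<close>

lemma pistonI: "\<gamma> > 1 \<Longrightarrow> E0 > 1/2 \<Longrightarrow> piston \<gamma> E0"
  by (simp add: piston_def)

lemma mach_at_top:
  assumes ps: "\<forall>\<^sub>F k in F. piston (g k) (e k)"
    and s: "((\<lambda>k. piston.s (g k) (e k)) \<longlongrightarrow> 0) F"
  shows "filterlim (\<lambda>k. mach (g k) (e k)) at_top F"
proof -
  have "filterlim (\<lambda>k. inverse (piston.s (g k) (e k))) at_top F"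
    by (rule filterlim_inverse_at_top[OF s]) (rule eventually_mono[OF ps piston.s_pos])
  then show ?thesis
    by (rule filterlim_mono_eventually) (use ps in \<open>auto elim!: eventually_mono simp: piston.s_def\<close>)
qed

lemma s_tendsto_0_energy:
  assumes "\<gamma> > 1"
  shows "((\<lambda>E0. piston.s \<gamma> E0) \<longlongrightarrow> 0) (at_right (1/2))"
proof -
  have "((\<lambda>E0. sqrt (\<gamma> * (\<gamma> - 1) * (E0 - 1/2))) \<longlongrightarrow> sqrt (\<gamma> * (\<gamma> - 1) * (1/2 - 1/2))) (at_right (1/2))"
    by (intro tendsto_intros)
  moreover have "\<forall>\<^sub>F E0 in at_right (1/2). sqrt (\<gamma> * (\<gamma> - 1) * (E0 - 1/2)) = piston.s \<gamma> E0"
    using eventually_at_right_less by eventually_elim (use assms in \<open>simp add: piston.s_eq pistonI\<close>)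
  ultimately show ?thesis using Lim_transform_eventually by fastforce
qed

lemma s_tendsto_0_gamma:
  assumes "E0 > 1/2"
  shows "((\<lambda>\<gamma>. piston.s \<gamma> E0) \<longlongrightarrow> 0) (at_right 1)"
proof -
  have "((\<lambda>\<gamma>. sqrt (\<gamma> * (\<gamma> - 1) * (E0 - 1/2))) \<longlongrightarrow> sqrt (1 * (1 - 1) * (E0 - 1/2))) (at_right 1)"
    by (intro tendsto_intros)
  moreover have "\<forall>\<^sub>F \<gamma> in at_right 1. sqrt (\<gamma> * (\<gamma> - 1) * (E0 - 1/2)) = piston.s \<gamma> E0"
    using eventually_at_right_less by eventually_elim (use assms in \<open>simp add: piston.s_eq pistonI\<close>)
  ultimately show ?thesis using Lim_transform_eventually by fastforce
qed

text \<open>The Mach number grows only like the inverse square root of \<gamma> - 1, so one factor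
  \<open>sqrt (\<gamma> - 1)\<close> survives in the product.\<close>

lemma mach_gamma_tendsto_0:
  assumes "E0 > 1/2"
  shows "((\<lambda>\<gamma>. (\<gamma> - 1) * mach \<gamma> E0) \<longlongrightarrow> 0) (at_right 1)"
proof -
  have "((\<lambda>\<gamma>. sqrt (\<gamma> - 1) / sqrt (\<gamma> * (E0 - 1/2))) \<longlongrightarrow> sqrt (1 - 1) / sqrt (1 * (E0 - 1/2))) (at_right 1)"
    using assms by (intro tendsto_intros) auto
  moreover have "\<forall>\<^sub>F \<gamma> in at_right 1. sqrt (\<gamma> - 1) / sqrt (\<gamma> * (E0 - 1/2)) = (\<gamma> - 1) * mach \<gamma> E0"
    using eventually_at_right_less
  proof eventually_elim
    case (elim \<gamma>)
    have "sqrt (\<gamma> * (\<gamma> - 1) * (E0 - 1/2)) = sqrt (\<gamma> - 1) * sqrt (\<gamma> * (E0 - 1/2))"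
      by (simp only: real_sqrt_mult[symmetric] ac_simps)
    then have "(\<gamma> - 1) * mach \<gamma> E0 = ((\<gamma> - 1) / sqrt (\<gamma> - 1)) / sqrt (\<gamma> * (E0 - 1/2))"
      by (simp only: mach_def) simp
    then show ?case using elim by (simp only: real_div_sqrt)
  qed
  ultimately show ?thesis using Lim_transform_eventually by fastforce
qed

text \<open>Here q is fixed and s tends to 0, so the vacuum edge q * s - 1 passes every \<xi> >
  -1.\<close>

lemma fan_density_vanishes_energy:
  assumes \<gamma>: "\<gamma> > 1" and \<xi>: "- 1 < \<xi>"
  shows "((\<lambda>E0. dens (piston.fan \<gamma> E0 \<xi>)) \<longlongrightarrow> 0) (at_right (1/2))"
proof -
  have q: "piston.q \<gamma> > 0" using piston.q_pos[OF pistonI[OF \<gamma>, of 1]] by simp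
  have "((\<lambda>E0. piston.q \<gamma> * piston.s \<gamma> E0) \<longlongrightarrow> piston.q \<gamma> * 0) (at_right (1/2))"
    by (intro tendsto_intros s_tendsto_0_energy[OF \<gamma>])
  \<comment> \<open>Being below 1 forces \<open>w1 = 0\<close>; being below 1 + \<xi> puts \<xi> to
    the right of the fan.\<close>
  then have "\<forall>\<^sub>F E0 in at_right (1/2). piston.q \<gamma> * piston.s \<gamma> E0 < min 1 (1 + \<xi>)"
    by (rule order_tendstoD) (use \<xi> in auto)
  then have "\<forall>\<^sub>F E0 in at_right (1/2). 0 = dens (piston.fan \<gamma> E0 \<xi>)"
    using eventually_at_right_less
  proof eventually_elim
    case (elim E0)
    then interpret piston \<gamma> E0 using \<gamma> by (simp add: pistonI)
    have "\<xi>R \<le> \<xi>" using elim by (auto simp: \<xi>R_def)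
    then show ?case using w1_zero elim by (simp add: fan_simps wave_right)
  qed
  then show ?thesis by (rule Lim_transform_eventually[OF tendsto_const])
qed

text \<open>With \<open>wave \<xi> = 1 - y\<close>, the bound 1 - y \<le> exp (- y) is raised to the
  power q. The product \<open>q * y\<close> equals q / (q + 1) times (1 + \<xi> + s) / s, in which q
  / (q + 1) \<ge> 1/2.\<close>

lemma (in piston) fan_density_le:
  assumes \<gamma>: "\<gamma> < 3" and no_vacuum: "q * s > 1"
    and \<xi>: "- 1 < \<xi>" "\<xi> < 1 / q - s" "\<xi> < 0"
  shows "dens (fan \<xi>) \<le> exp (- ((1 + \<xi>) / (2 * s)))"
proof -
  \<comment> \<open>This is where \<gamma> < 3 enters; it yields the factor 1/2 in the
    exponent.\<close>
  have q: "q \<ge> 1" using \<gamma> gamma by (simp add: q_def field_simps)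
  define y where "y = (1 + \<xi> + s) / ((q + 1) * s)"
  have mid: "\<xi>L < \<xi>" "\<xi> < \<xi>R"
    using \<xi> no_vacuum s_pos by (auto simp: \<xi>L_def \<xi>R_def)
  have w: "wave \<xi> = 1 - y" "0 < wave \<xi>"
    using wave_mid[of \<xi>] wave_mid_bounds(3)[OF mid] mid by (auto simp: y_def)
  have "wave \<xi> powr q \<le> exp (- y) powr q"
    using w q exp_ge_add_one_self[of "- y"] by (intro powr_mono2) auto
  also have "\<dots> = exp (- (q * y))" by (simp add: powr_def)
  also have "\<dots> \<le> exp (- ((1 + \<xi>) / (2 * s)))"
  proof -
    have "(1 + \<xi>) / (2 * s) = (1 / 2) * ((1 + \<xi>) / s)" by simp
    also have "\<dots> \<le> (q / (q + 1)) * ((1 + \<xi> + s) / s)"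
      using \<xi> s_pos q by (intro mult_mono divide_right_mono) (auto simp: field_simps)
    also have "\<dots> = q * y" by (simp add: y_def)
    finally show ?thesis by simp
  qed
  finally show ?thesis by (simp add: fan_simps)
qed

text \<open>Both the Mach number and the threshold 2 / (\<gamma> - 1) blow up, so their comparison
  goes through the product (\<gamma> - 1) * M0, which tends to 0.\<close>

lemma no_vacuum_eventually:
  assumes "E0 > 1/2"
  shows "\<forall>\<^sub>F \<gamma> in at_right 1. mach \<gamma> E0 < 2 / (\<gamma> - 1)"
proof -
  have "\<forall>\<^sub>F \<gamma> in at_right 1. (\<gamma> - 1) * mach \<gamma> E0 < 2"
    using order_tendstoD(2)[OF mach_gamma_tendsto_0[OF assms], of 2] by simp
  then show ?thesis
    using eventually_at_right_less by eventually_elim (simp add: field_simps)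
qed

text \<open>A fixed ray -1 < \<xi> < 0 eventually lies inside the fan, where the exponent (1 +
  \<xi>) / (2 * s) grows without bound.\<close>

lemma fan_density_vanishes_gamma:
  assumes E0: "E0 > 1/2" and \<xi>: "- 1 < \<xi>" "\<xi> < 0"
  shows "((\<lambda>\<gamma>. dens (piston.fan \<gamma> E0 \<xi>)) \<longlongrightarrow> 0) (at_right 1)"
proof -
  note s = s_tendsto_0_gamma[OF E0]
  \<comment> \<open>This gives \<xi> < - s < 1 / q - s, so \<xi> lies before the constant state at
    the piston.\<close>
  have small: "\<forall>\<^sub>F \<gamma> in at_right 1. piston.s \<gamma> E0 < - \<xi>"
    by (rule order_tendstoD(2)[OF s]) (use \<xi> in simp)
  have ev: "\<forall>\<^sub>F \<gamma> in at_right 1. 1 < \<gamma> \<and> \<gamma> < (3 :: real)"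
    using eventually_at_right_real[of 1 "3 :: real"] by simp
  have "filterlim (\<lambda>\<gamma>. inverse (piston.s \<gamma> E0)) at_top (at_right 1)"
  proof (rule filterlim_inverse_at_top[OF s])
    show "\<forall>\<^sub>F \<gamma> in at_right 1. 0 < piston.s \<gamma> E0"
      using eventually_at_right_less by eventually_elim (rule piston.s_pos[OF pistonI[OF _ E0]])
  qed
  then have "filterlim (\<lambda>\<gamma>. (1 + \<xi>) / 2 * inverse (piston.s \<gamma> E0)) at_top (at_right 1)"
    using \<xi> by (intro filterlim_tendsto_pos_mult_at_top[OF tendsto_const]) auto
  then have "((\<lambda>\<gamma>. exp (- ((1 + \<xi>) / 2 * inverse (piston.s \<gamma> E0)))) \<longlongrightarrow> 0) (at_right 1)"
    by (intro filterlim_compose[OF exp_at_bot]) (simp add: filterlim_uminus_at_bot)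
  moreover have "\<forall>\<^sub>F \<gamma> in at_right 1. norm (dens (piston.fan \<gamma> E0 \<xi>))
      \<le> exp (- ((1 + \<xi>) / 2 * inverse (piston.s \<gamma> E0)))"
    using no_vacuum_eventually[OF E0] ev small
  proof eventually_elim
    case (elim \<gamma>)
    then interpret piston \<gamma> E0 using E0 by (simp add: pistonI)
    have qs: "q * s > 1" using elim by (simp only: mach_le_iff(2))
    have "0 < 1 / q" using q_pos by simp
    then have \<xi>R: "\<xi> < 1 / q - s" using elim by linarith
    have \<gamma>: "\<gamma> < 3" using elim by simp
    have "dens (fan \<xi>) \<le> exp (- ((1 + \<xi>) / (2 * s)))"
      by (rule fan_density_le[OF \<gamma> qs \<xi>(1) \<xi>R \<xi>(2)])
    moreover have "(1 + \<xi>) / (2 * s) = (1 + \<xi>) / 2 * inverse s" by (simp add: field_simps)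
    moreover have "0 \<le> dens (fan \<xi>)" using rho_bounds(1) by (simp only: fan_simps)
    ultimately show ?case by simp
  qed
  ultimately show ?thesis by (rule Lim_null_comparison[rotated])
qed

theorem mainTheorem2:
  shows
  "(\<forall>\<gamma> E0. \<gamma> > 1 \<and> E0 > 1/2 \<longrightarrow> (\<exists>V. piston_solution \<gamma> E0 V))
   \<and> (\<forall>\<gamma> V. \<gamma> > 1 \<and> (\<forall>E0. E0 > 1/2 \<longrightarrow> piston_solution \<gamma> E0 (V E0)) \<longrightarrow>
        filterlim (\<lambda>E0. mach \<gamma> E0) at_top (at_right (1/2))
      \<and> (\<forall>\<^sub>F E0 in at_right (1/2). mach \<gamma> E0 > 2 / (\<gamma> - 1))
      \<and> measures_converge (\<lambda>_. \<gamma>) V (at_right (1/2)) (limit_profile (1/2))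
      \<and> pressureless_weak_solution (ss_field (limit_profile (1/2)))
          (\<lambda>_. 1) (\<lambda>_. -1) (\<lambda>_. 1/2))
   \<and> (\<forall>E0 V. E0 > 1/2 \<and> (\<forall>\<gamma>. \<gamma> > 1 \<longrightarrow> piston_solution \<gamma> E0 (V \<gamma>)) \<longrightarrow>
        filterlim (\<lambda>\<gamma>. mach \<gamma> E0) at_top (at_right 1)
      \<and> ((\<lambda>\<gamma>. (\<gamma> - 1) * mach \<gamma> E0) \<longlongrightarrow> 0) (at_right 1)
      \<and> (\<forall>\<^sub>F \<gamma> in at_right 1. mach \<gamma> E0 < 2 / (\<gamma> - 1))
      \<and> measures_converge (\<lambda>\<gamma>. \<gamma>) V (at_right 1) (limit_profile E0)
      \<and> pressureless_weak_solution (ss_field (limit_profile E0))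
          (\<lambda>_. 1) (\<lambda>_. -1) (\<lambda>_. E0))"
proof (intro conjI)
  show "\<forall>\<gamma> E0. \<gamma> > 1 \<and> E0 > 1/2 \<longrightarrow> (\<exists>V. piston_solution \<gamma> E0 V)"
    using piston.fan_solution[OF pistonI] by blast
next
  show "\<forall>\<gamma> V. \<gamma> > 1 \<and> (\<forall>E0. E0 > 1/2 \<longrightarrow> piston_solution \<gamma> E0 (V E0)) \<longrightarrow>
        filterlim (\<lambda>E0. mach \<gamma> E0) at_top (at_right (1/2))
      \<and> (\<forall>\<^sub>F E0 in at_right (1/2). mach \<gamma> E0 > 2 / (\<gamma> - 1))
      \<and> measures_converge (\<lambda>_. \<gamma>) V (at_right (1/2)) (limit_profile (1/2))
      \<and> pressureless_weak_solution (ss_field (limit_profile (1/2)))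
          (\<lambda>_. 1) (\<lambda>_. -1) (\<lambda>_. 1/2)"
  proof (intro allI impI)
    fix \<gamma> :: real and V :: "real \<Rightarrow> real \<Rightarrow> state"
    assume "\<gamma> > 1 \<and> (\<forall>E0. E0 > 1/2 \<longrightarrow> piston_solution \<gamma> E0 (V E0))"
    then have \<gamma>: "\<gamma> > 1" and V: "\<And>E0. E0 > 1/2 \<Longrightarrow> piston_solution \<gamma> E0 (V E0)" by auto
    have top: "filterlim (\<lambda>E0. mach \<gamma> E0) at_top (at_right (1/2))"
      by (rule mach_at_top[OF _ s_tendsto_0_energy[OF \<gamma>]])
        (rule eventually_mono[OF eventually_at_right_less pistonI[OF \<gamma>]])
    \<comment> \<open>With \<gamma> fixed the threshold is a constant, so divergence of the Mach
      number suffices.\<close>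
    moreover have "\<forall>\<^sub>F E0 in at_right (1/2). mach \<gamma> E0 > 2 / (\<gamma> - 1)"
      using top by (simp add: filterlim_at_top_dense)
    moreover have "measures_converge (\<lambda>_. \<gamma>) V (at_right (1/2)) (limit_profile (1/2))"
    proof (rule measures_converge_fan[where e = "\<lambda>E0. E0"])
      have "((\<lambda>E0. (\<gamma> - 1) * (E0 - 1/2)) \<longlongrightarrow> (\<gamma> - 1) * (1/2 - 1/2)) (at_right (1/2))"
        by (intro tendsto_intros)
      then show "((\<lambda>E0. (\<gamma> - 1) * (E0 - 1/2)) \<longlongrightarrow> 0) (at_right (1/2))" by simp
    qed (use \<gamma> V s_tendsto_0_energy fan_density_vanishes_energy in \<open>auto intro: pistonI tendsto_ident_at\<close>)
    ultimately show "filterlim (\<lambda>E0. mach \<gamma> E0) at_top (at_right (1/2))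
      \<and> (\<forall>\<^sub>F E0 in at_right (1/2). mach \<gamma> E0 > 2 / (\<gamma> - 1))
      \<and> measures_converge (\<lambda>_. \<gamma>) V (at_right (1/2)) (limit_profile (1/2))
      \<and> pressureless_weak_solution (ss_field (limit_profile (1/2)))
          (\<lambda>_. 1) (\<lambda>_. -1) (\<lambda>_. 1/2)"
      using limit_profile_weak_solution by blast
  qed
next
  show "\<forall>E0 V. E0 > 1/2 \<and> (\<forall>\<gamma>. \<gamma> > 1 \<longrightarrow> piston_solution \<gamma> E0 (V \<gamma>)) \<longrightarrow>
        filterlim (\<lambda>\<gamma>. mach \<gamma> E0) at_top (at_right 1)
      \<and> ((\<lambda>\<gamma>. (\<gamma> - 1) * mach \<gamma> E0) \<longlongrightarrow> 0) (at_right 1)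
      \<and> (\<forall>\<^sub>F \<gamma> in at_right 1. mach \<gamma> E0 < 2 / (\<gamma> - 1))
      \<and> measures_converge (\<lambda>\<gamma>. \<gamma>) V (at_right 1) (limit_profile E0)
      \<and> pressureless_weak_solution (ss_field (limit_profile E0))
          (\<lambda>_. 1) (\<lambda>_. -1) (\<lambda>_. E0)"
  proof (intro allI impI)
    fix E0 :: real and V :: "real \<Rightarrow> real \<Rightarrow> state"
    assume "E0 > 1/2 \<and> (\<forall>\<gamma>. \<gamma> > 1 \<longrightarrow> piston_solution \<gamma> E0 (V \<gamma>))"
    then have E0: "E0 > 1/2" and V: "\<And>\<gamma>. \<gamma> > 1 \<Longrightarrow> piston_solution \<gamma> E0 (V \<gamma>)" by auto
    have "filterlim (\<lambda>\<gamma>. mach \<gamma> E0) at_top (at_right 1)"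
      by (rule mach_at_top[OF _ s_tendsto_0_gamma[OF E0]])
        (rule eventually_mono[OF eventually_at_right_less pistonI[OF _ E0]])
    moreover have "measures_converge (\<lambda>\<gamma>. \<gamma>) V (at_right 1) (limit_profile E0)"
    proof (rule measures_converge_fan[where e = "\<lambda>_. E0"])
      have "((\<lambda>\<gamma>. (\<gamma> - 1) * (E0 - 1/2)) \<longlongrightarrow> (1 - 1) * (E0 - 1/2)) (at_right 1)"
        by (intro tendsto_intros)
      then show "((\<lambda>\<gamma>. (\<gamma> - 1) * (E0 - 1/2)) \<longlongrightarrow> 0) (at_right 1)" by simp
    qed (use E0 V s_tendsto_0_gamma fan_density_vanishes_gamma in \<open>auto intro: pistonI\<close>)
    ultimately show "filterlim (\<lambda>\<gamma>. mach \<gamma> E0) at_top (at_right 1)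
      \<and> ((\<lambda>\<gamma>. (\<gamma> - 1) * mach \<gamma> E0) \<longlongrightarrow> 0) (at_right 1)
      \<and> (\<forall>\<^sub>F \<gamma> in at_right 1. mach \<gamma> E0 < 2 / (\<gamma> - 1))
      \<and> measures_converge (\<lambda>\<gamma>. \<gamma>) V (at_right 1) (limit_profile E0)
      \<and> pressureless_weak_solution (ss_field (limit_profile E0))
          (\<lambda>_. 1) (\<lambda>_. -1) (\<lambda>_. E0)"
      using mach_gamma_tendsto_0[OF E0] no_vacuum_eventually[OF E0] limit_profile_weak_solution by blast
  qed
qed

end
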